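(* Let $G(x,y,z)$ be the generating function in which the coefficient of $x^ry^dz^n$ is the number of noncrossing trees with $n$ edges where node $r$ has depth $d$ (for $0\le r\le n$). Then $$G(x,y,z)=\frac{T(z)+y(1-T(z))T(xz)}{1-yzT(z)T(xz)\left(T(z)+xT(xz)\right)}.$$
   Context: A noncrossing tree with $n$ edges is a tree whose $n+1$ nodes are points on the boundary of a circle, labeled $0,1,\dots,n$ in counterclockwise order around the circle, and whose edges are straight segments that do not cross. It is regarded as rooted at node $0$. The depth of a node is the number of edges in the path from node $0$ to it. $T(z)$ denotes the generating function for noncrossing trees where $z$ marks the number of edges; it is the formal power series satisfying $T(z)-1=zT(z)^3$, that is, $T(z)=\sum_{n\ge0}\frac{1}{2n+1}\binom{3n}{n}z^n$. *)

theory Defs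
  imports "HOL-Analysis.Analysis" "HOL-Computational_Algebra.Formal_Power_Series"
begin

text \<open>A simple graph is given by its node set \<open>V\<close> and a set \<open>E\<close> of two-element edges.
  A path is the list of the nodes it visits, so its number of edges is its length minus one.\<close>

definition simple_graph :: "'a set \<Rightarrow> 'a set set \<Rightarrow> bool" where
  "simple_graph V E \<longleftrightarrow> finite V \<and> (\<forall>e\<in>E. e \<subseteq> V \<and> card e = 2)"

definition path_between :: "'a set set \<Rightarrow> 'a \<Rightarrow> 'a list \<Rightarrow> 'a \<Rightarrow> bool" where
  "path_between E u p v \<longleftrightarrow>
     p \<noteq> [] \<and> hd p = u \<and> last p = v \<and> distinct p \<and> successively (\<lambda>a b. {a, b} \<in> E) p"

definition graph_cycle :: "'a set set \<Rightarrow> 'a list \<Rightarrow> bool" where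
  "graph_cycle E c \<longleftrightarrow>
     3 \<le> length c \<and> distinct c \<and> successively (\<lambda>a b. {a, b} \<in> E) c \<and> {last c, hd c} \<in> E"

definition graph_tree :: "'a set \<Rightarrow> 'a set set \<Rightarrow> bool" where
  "graph_tree V E \<longleftrightarrow> simple_graph V E \<and> V \<noteq> {} \<and>
     (\<forall>u\<in>V. \<forall>v\<in>V. \<exists>p. path_between E u p v) \<and> (\<nexists>c. graph_cycle E c)"

text \<open>The nodes \<open>0, \<dots>, n\<close> are placed counterclockwise and equally spaced on the unit circle.\<close>

definition circle_point :: "nat \<Rightarrow> nat \<Rightarrow> complex" where
  "circle_point n k = cis (2 * pi * real k / real (n + 1))"

text \<open>Edges may meet in a common end node, hence the open segments.\<close>

definition noncrossing :: "nat \<Rightarrow> nat set set \<Rightarrow> bool" where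
  "noncrossing n E \<longleftrightarrow>
     (\<forall>a b c d. {a, b} \<in> E \<longrightarrow> {c, d} \<in> E \<longrightarrow> {a, b} \<noteq> {c, d} \<longrightarrow>
        open_segment (circle_point n a) (circle_point n b) \<inter>
        open_segment (circle_point n c) (circle_point n d) = {})"

definition noncrossing_trees :: "nat \<Rightarrow> nat set set set" where
  "noncrossing_trees n = {E. graph_tree {0..n} E \<and> noncrossing n E}"

definition depth :: "nat set set \<Rightarrow> nat \<Rightarrow> nat" where
  "depth E r = length (THE p. path_between E 0 p r) - 1"

text \<open>Power series in \<open>x\<close>, \<open>y\<close>, \<open>z\<close> are represented as power series in \<open>z\<close>, whose coefficients
  are power series in \<open>y\<close>, whose coefficients are power series in \<open>x\<close>: the coefficient of
  \<open>x\<^sup>r y\<^sup>d z\<^sup>n\<close> in \<open>f\<close> is \<open>f $ n $ d $ r\<close>.\<close>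

type_synonym series = "rat fps fps fps"

definition var_x :: series where "var_x = fps_const (fps_const fps_X)"
definition var_y :: series where "var_y = fps_const fps_X"
definition var_z :: series where "var_z = fps_X"

text \<open>\<open>T w\<close> substitutes \<open>w\<close> (with zero constant term in \<open>z\<close>) into the generating function
  of noncrossing trees by number of edges.\<close>

definition T :: "series \<Rightarrow> series" where
  "T w = fps_compose (Abs_fps (\<lambda>n. of_nat (card (noncrossing_trees n)))) w"

definition G :: series where
  "G = Abs_fps (\<lambda>n. Abs_fps (\<lambda>d. Abs_fps (\<lambda>r.
         of_nat (card {E \<in> noncrossing_trees n. r \<le> n \<and> depth E r = d}))))"

end

theory Submission
  imports Defs
begin

text \<open>
  The formula follows from two decompositions of noncrossing trees, in which the interval of nodes
  is divided into shorter intervals.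

  If the tree has at least one edge, let \<open>c\<close> be the last neighbour of node \<open>0\<close>.  No edge can pass over
  \<open>c\<close>, so the tree is glued at \<open>c\<close> from a tree on \<open>{0..c}\<close> that contains the edge \<open>{0, c}\<close> and an
  arbitrary tree on \<open>{c..n}\<close>, whose nodes are one level deeper than in that tree itself
  (\<open>bij_betw_last_neighbour\<close>, \<open>node_sum_last_neighbour\<close>).

  If the tree contains the edge \<open>{0, n}\<close>, its removal leaves a tree on \<open>{0..a}\<close> and a tree on
  \<open>{a + 1..n}\<close> for some \<open>a\<close> (\<open>bij_betw_outer_edge\<close>, \<open>node_sum_outer_edge\<close>).  Distances in the second
  tree have to be taken from its last node \<open>n\<close>.  Noncrossing trees are invariant under rotation, so it
  may be renumbered with \<open>n\<close> as node \<open>0\<close>; then its contribution is again given by \<open>G\<close>, except that the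
  exponent of \<open>x\<close> is changed for the root.  This rotation makes the system of equations close
  up with \<open>G\<close> as its only unknown apart from \<open>T\<close>.

  For the generating functions, with \<open>A = T(z)\<close> and \<open>B = T(xz)\<close>, this yields \<open>A = 1 + z A\<^sup>3\<close> and
    \<open>G = A + y z A\<^sup>2 B (G - A) + x y z A B\<^sup>2 G\<close>
  (\<open>generating_function_equations\<close>).  The second equation also has a direct reading:
  its terms belong to \<open>r = 0\<close> and, for the other nodes \<open>r\<close>, to the cases that the first edge of the
  path from \<open>0\<close> to \<open>r\<close> leads to a node after \<open>r\<close>, or to one not after \<open>r\<close>.
  It is linear in \<open>G\<close>, and \<open>z A\<^sup>3 = A - 1\<close> gives the stated numerator.

  The definitions enter in two places.  The segments in the plane are eliminated by
  \<open>noncrossing_iff_crossing_free\<close>, where orientations of triangles show that two chords meet iff their ends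
  alternate.  Connectedness and acyclicity are replaced by a condition on cuts
  (\<open>graph_tree_iff_cut_tree\<close>), which behaves well under gluing (\<open>cut_tree_glue\<close>).
\<close>

section \<open>Trees described by cuts\<close>

text \<open>A set \<open>S\<close> of nodes is thought of as a cut; an edge crosses it iff it has one end in \<open>S\<close> and the other
  outside.  A tree is a graph in which every proper cut is crossed (connectedness) and every edge
  is the only one to cross some cut (each edge is a bridge, so there are no cycles).  In this form
  gluing, dividing and relabelling of trees are manipulations of cuts; paths are needed only for
  the equivalence with the usual definition and for depths.\<close>

definition splits :: "'a set \<Rightarrow> 'a set \<Rightarrow> bool" where
  "splits S A \<longleftrightarrow> A \<inter> S \<noteq> {} \<and> \<not> A \<subseteq> S"

definition cut_tree :: "'a set \<Rightarrow> 'a set set \<Rightarrow> bool" where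
  "cut_tree V E \<longleftrightarrow> simple_graph V E \<and> V \<noteq> {} \<and>
     (\<forall>S. splits S V \<longrightarrow> (\<exists>e\<in>E. splits S e)) \<and>
     (\<forall>e\<in>E. \<exists>S. \<forall>e'\<in>E. splits S e' \<longleftrightarrow> e' = e)"

lemma cut_tree_bridge:
  assumes "cut_tree V E" "e \<in> E"
  obtains S where "\<And>e'. e' \<in> E \<Longrightarrow> splits S e' \<longleftrightarrow> e' = e"
proof -
  have "\<exists>S. \<forall>e'\<in>E. splits S e' \<longleftrightarrow> e' = e" using assms by (simp add: cut_tree_def)
  then show ?thesis using that by auto
qed

lemma cut_tree_connected:
  assumes "cut_tree V E" "splits S V"
  shows "\<exists>e\<in>E. splits S e"
  using assms by (simp add: cut_tree_def)

lemma splits_pair: "splits S {u, v} \<longleftrightarrow> (u \<in> S \<longleftrightarrow> v \<notin> S)"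
  by (auto simp: splits_def)

lemma splits_Compl: "splits (- S) A \<longleftrightarrow> splits S A"
  by (auto simp: splits_def)

lemma splits_vimage: "splits S (f ` A) \<longleftrightarrow> splits (f -` S) A"
  by (auto simp: splits_def)

lemma splits_cong: "A \<inter> S = A \<inter> S' \<Longrightarrow> splits S A \<longleftrightarrow> splits S' A"
  by (auto simp: splits_def)

lemma walk_splits:
  assumes "p \<noteq> []" "successively (\<lambda>a b. {a, b} \<in> E) p" "hd p \<in> S \<longleftrightarrow> last p \<notin> S"
  shows "\<exists>xs a b ys. p = xs @ a # b # ys \<and> {a, b} \<in> E \<and> splits S {a, b}"
  using assms
proof (induction p)
  case (Cons a p)
  show ?case
  proof (cases p)
    case (Cons b q)
    show ?thesis
    proof (cases "a \<in> S \<longleftrightarrow> b \<in> S")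
      case True
      with Cons.IH Cons.prems Cons obtain xs a' b' ys where
        "p = xs @ a' # b' # ys \<and> {a', b'} \<in> E \<and> splits S {a', b'}"
        by (auto simp: successively_Cons)
      then have "a # p = (a # xs) @ a' # b' # ys \<and> {a', b'} \<in> E \<and> splits S {a', b'}" by simp
      then show ?thesis by blast
    next
      case False
      have "a # p = [] @ a # b # q \<and> {a, b} \<in> E \<and> splits S {a, b}"
        using Cons.prems Cons False by (auto simp: splits_pair)
      then show ?thesis by blast
    qed
  qed (use Cons.prems in auto)
qed simp

lemma path_splits:
  assumes "path_between E u p v" "u \<in> S \<longleftrightarrow> v \<notin> S"
  obtains a b where "a \<in> set p" "b \<in> set p" "{a, b} \<in> E" "splits S {a, b}"
proof -
  have "\<exists>xs a b ys. p = xs @ a # b # ys \<and> {a, b} \<in> E \<and> splits S {a, b}"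
    by (rule walk_splits) (use assms in \<open>auto simp: path_between_def\<close>)
  then obtain xs a b ys where "p = xs @ a # b # ys" "{a, b} \<in> E" "splits S {a, b}" by blast
  then show ?thesis using that[of a b] by simp
qed

lemma rtrancl_path:
  assumes "(u, v) \<in> {(a, b). {a, b} \<in> E}\<^sup>*"
  shows "\<exists>p. path_between E u p v"
  using assms
proof (induction rule: rtrancl_induct)
  case base
  have "path_between E u [u] u" by (simp add: path_between_def)
  then show ?case by blast
next
  case (step w v)
  then obtain p where p: "path_between E u p w" by blast
  show ?case
  proof (cases "v \<in> set p")
    case True
    then obtain xs ys where xs: "p = xs @ v # ys" by (auto simp: in_set_conv_decomp)
    have "path_between E u (xs @ [v]) v"
      using p unfolding xs path_between_def
      by (auto simp: successively_append_iff hd_append split: if_splits)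
    then show ?thesis by blast
  next
    case False
    have "path_between E u (p @ [v]) v"
      using p False step(2) unfolding path_between_def
      by (auto simp: successively_append_iff)
    then show ?thesis by blast
  qed
qed

text \<open>Otherwise the set of nodes reachable from \<open>u\<close> would split no edge.\<close>

lemma cut_connected_path:
  assumes "\<And>S. splits S V \<Longrightarrow> \<exists>e\<in>E. splits S e" "\<And>e. e \<in> E \<Longrightarrow> card e = 2" "u \<in> V" "v \<in> V"
  shows "\<exists>p. path_between E u p v"
proof (rule ccontr)
  define S where "S = {w. (u, w) \<in> {(a, b). {a, b} \<in> E}\<^sup>*}"
  assume "\<not> ?thesis"
  then have "v \<notin> S" using rtrancl_path[of u v E] unfolding S_def by blast
  moreover have "u \<in> S" by (simp add: S_def)
  ultimately have "splits S V" using assms by (auto simp: splits_def)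
  then obtain e where e: "e \<in> E" "splits S e" using assms(1) by blast
  then obtain a b where ab: "e = {a, b}" using assms(2) by (meson card_2_iff)
  have "a \<in> S \<longleftrightarrow> b \<in> S" using e(1)
    unfolding S_def ab by (auto intro: rtrancl_into_rtrancl simp: insert_commute)
  then show False using e(2) by (simp add: ab splits_pair)
qed

text \<open>The cut consists of the nodes that one end of \<open>e\<close> reaches without using \<open>e\<close>.  If it contained
  the other end, a path between the two ends would close up with \<open>e\<close> to a cycle.\<close>

lemma acyclic_bridge:
  assumes "\<nexists>c. graph_cycle E c" "\<And>e. e \<in> E \<Longrightarrow> card e = 2" "e \<in> E"
  shows "\<exists>S. \<forall>e'\<in>E. splits S e' \<longleftrightarrow> e' = e"
proof -
  obtain u v where e: "e = {u, v}" "u \<noteq> v" using assms(2,3) by (meson card_2_iff)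
  define S where "S = {w. (u, w) \<in> {(a, b). {a, b} \<in> E - {e}}\<^sup>*}"
  have "v \<notin> S"
  proof
    assume "v \<in> S"
    then obtain p where p: "path_between (E - {e}) u p v"
      using rtrancl_path[of u v "E - {e}"] by (auto simp: S_def)
    have "graph_cycle E p"
    proof -
      have "successively (\<lambda>a b. {a, b} \<in> E) p"
        using p unfolding path_between_def by (auto elim: successively_mono)
      moreover have "3 \<le> length p"
      proof (rule ccontr)
        assume "\<not> 3 \<le> length p"
        then have "length p = 0 \<or> length p = 1 \<or> length p = 2" by linarith
        with p have "p = [u] \<or> p = [u, v]"
          by (auto simp: path_between_def length_Suc_conv numeral_2_eq_2)
        then show False using p e by (elim disjE) (simp_all add: path_between_def)
      qed
      ultimately show ?thesis
        using p assms(3) e by (auto simp: path_between_def graph_cycle_def insert_commute)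
    qed
    with assms(1) show False by blast
  qed
  moreover have "u \<in> S" by (simp add: S_def)
  ultimately have "splits S e" by (simp add: e splits_pair)
  moreover have "\<not> splits S e'" if e': "e' \<in> E" "e' \<noteq> e" for e'
  proof -
    obtain a b where ab: "e' = {a, b}" using assms(2) e'(1) by (meson card_2_iff)
    have "a \<in> S \<longleftrightarrow> b \<in> S" using e'
      unfolding S_def ab by (auto intro: rtrancl_into_rtrancl simp: insert_commute)
    then show ?thesis by (simp add: ab splits_pair)
  qed
  ultimately show ?thesis by blast
qed

text \<open>A cut that separates the two ends of the closing edge \<open>{last c, hd c}\<close> must be crossed a second
  time on the way round the cycle.\<close>

lemma bridges_acyclic:
  assumes "\<And>e. e \<in> E \<Longrightarrow> \<exists>S. \<forall>e'\<in>E. splits S e' \<longleftrightarrow> e' = e"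
  shows "\<not> graph_cycle E c"
proof
  assume c: "graph_cycle E c"
  then have ne: "c \<noteq> []" by (auto simp: graph_cycle_def)
  from c obtain S where S: "\<And>e'. e'\<in>E \<Longrightarrow> splits S e' \<longleftrightarrow> e' = {last c, hd c}"
    using assms[of "{last c, hd c}"] by (auto simp: graph_cycle_def)
  have "splits S {last c, hd c}" using S[of "{last c, hd c}"] c by (simp add: graph_cycle_def)
  then have sep: "hd c \<in> S \<longleftrightarrow> last c \<notin> S" by (auto simp: splits_pair)
  have "successively (\<lambda>a b. {a, b} \<in> E) c" using c by (simp add: graph_cycle_def)
  from walk_splits[OF ne this sep]
  obtain xs a b ys where p: "c = xs @ a # b # ys" "{a, b} \<in> E" "splits S {a, b}" by blast
  have "{a, b} = {last c, hd c}" using S[OF p(2)] p(3) by simp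
  then show False using c p(1) unfolding graph_cycle_def
    by (cases xs; cases ys rule: rev_cases) (auto simp: doubleton_eq_iff)
qed

lemma graph_tree_iff_cut_tree: "graph_tree V E \<longleftrightarrow> cut_tree V E"
proof
  assume t: "graph_tree V E"
  then have c2: "\<And>e. e \<in> E \<Longrightarrow> card e = 2" by (auto simp: graph_tree_def simple_graph_def)
  have "\<exists>e\<in>E. splits S e" if "splits S V" for S
  proof -
    obtain u v where uv: "u \<in> V" "v \<in> V" "u \<in> S" "v \<notin> S" using \<open>splits S V\<close>
      by (auto simp: splits_def)
    then obtain p where "path_between E u p v" using t unfolding graph_tree_def by blast
    then obtain a b where "{a, b} \<in> E" "splits S {a, b}"
      using path_splits[of E u p v S] uv by blast
    then show ?thesis by blast
  qed
  then show "cut_tree V E" using t acyclic_bridge[of E] c2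
    by (auto simp: graph_tree_def cut_tree_def)
next
  assume t: "cut_tree V E"
  then have c2: "\<And>e. e \<in> E \<Longrightarrow> card e = 2" by (auto simp: cut_tree_def simple_graph_def)
  show "graph_tree V E"
    unfolding graph_tree_def
  proof (intro conjI)
    show "\<forall>u\<in>V. \<forall>v\<in>V. \<exists>p. path_between E u p v"
      using t c2 cut_connected_path[of V E] by (auto simp: cut_tree_def)
    show "\<nexists>c. graph_cycle E c"
      using t bridges_acyclic[of E] by (auto simp: cut_tree_def)
  qed (use t in \<open>auto simp: cut_tree_def\<close>)
qed

text \<open>If two paths from \<open>u\<close> diverge at once, along \<open>{u, b}\<close> and \<open>{u, c}\<close>, consider the cut that only
  \<open>{u, b}\<close> crosses.  The rest of either path avoids \<open>u\<close> and hence never crosses this cut, so \<open>b\<close>, \<open>v\<close>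
  and \<open>c\<close> are all on one side, but \<open>u\<close> and \<open>c\<close> are on the same side and \<open>u\<close> and \<open>b\<close> are not.\<close>

lemma cut_tree_path_unique:
  assumes "cut_tree V E"
    and "path_between E u p v" "path_between E u q v"
  shows "p = q"
  using assms(2,3)
proof (induction p arbitrary: u q)
  case Nil
  then show ?case by (simp add: path_between_def)
next
  case (Cons a p)
  then obtain q' where q: "q = u # q'" and a: "a = u" by (cases q) (auto simp: path_between_def)
  show ?case
  proof (cases "p = [] \<or> q' = []")
    case True
    then show ?thesis using Cons.prems a q by (auto simp: path_between_def split: if_splits)
  next
    case False
    define b c where "b = hd p" and "c = hd q'"
    have p': "path_between E b p v" and q': "path_between E c q' v"
      and bE: "{u, b} \<in> E" and cE: "{u, c} \<in> E" and un: "u \<notin> set p" "u \<notin> set q'"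
      using Cons.prems False a q by (auto simp: path_between_def b_def c_def successively_Cons)
    have "b = c"
    proof (rule ccontr)
      assume bc: "b \<noteq> c"
      obtain S where S: "\<And>e'. e'\<in>E \<Longrightarrow> splits S e' \<longleftrightarrow> e' = {u, b}" 
        using cut_tree_bridge[OF assms(1) bE] by auto
      have "u \<in> S \<longleftrightarrow> b \<notin> S" using S[OF bE] by (simp add: splits_pair)
      moreover have "b \<in> S \<longleftrightarrow> v \<in> S"
      proof (rule ccontr)
        assume "\<not> ?thesis"
        then obtain x y where "x \<in> set p" "y \<in> set p" "{x, y} \<in> E" "splits S {x, y}"
          using path_splits[OF p', of S] by blast
        then have "u \<in> set p" using S[of "{x, y}"] by (auto simp: doubleton_eq_iff)
        with un show False by blast
      qed
      moreover have "c \<in> S \<longleftrightarrow> v \<in> S"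
      proof (rule ccontr)
        assume "\<not> ?thesis"
        then obtain x y where "x \<in> set q'" "y \<in> set q'" "{x, y} \<in> E" "splits S {x, y}"
          using path_splits[OF q', of S] by blast
        then have "u \<in> set q'" using S[of "{x, y}"] by (auto simp: doubleton_eq_iff)
        with un show False by blast
      qed
      moreover have "u \<in> S \<longleftrightarrow> c \<in> S"
        using S[OF cE] bc by (auto simp: splits_pair doubleton_eq_iff)
      ultimately show False by blast
    qed
    then have "p = q'" using Cons.IH[OF p'] q' by simp
    then show ?thesis using q a by simp
  qed
qed

lemma depth_eq:
  assumes "cut_tree V E" "path_between E 0 p r"
  shows "depth E r = length p - 1"
proof -
  have "(THE p. path_between E 0 p r) = p"
    by (rule the_equality, rule assms(2), rule cut_tree_path_unique[OF assms(1) _ assms(2)])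
  then show ?thesis by (simp add: depth_def)
qed

lemma cut_tree_path:
  assumes "cut_tree V E" "u \<in> V" "v \<in> V"
  obtains p where "path_between E u p v"
proof -
  have "card e = 2" if "e \<in> E" for e
    using assms(1) that unfolding cut_tree_def simple_graph_def by simp
  then have "\<exists>p. path_between E u p v"
    using cut_connected_path[OF cut_tree_connected[OF assms(1)]] assms(2,3) by blast
  with that show ?thesis by blast
qed

lemma path_between_subset:
  assumes "path_between E u p v" "\<And>e. e \<in> E \<Longrightarrow> e \<subseteq> V" "u \<in> V"
  shows "set p \<subseteq> V"
proof -
  have "successively (\<lambda>a b. {a, b} \<in> E) p \<Longrightarrow> p \<noteq> [] \<Longrightarrow> hd p \<in> V \<Longrightarrow> set p \<subseteq> V" for p
  proof (induction p)
    case (Cons a p)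
    then show ?case using assms(2)[of "{a, hd p}"] by (cases p) auto
  qed simp
  then show ?thesis using assms by (auto simp: path_between_def)
qed

lemma path_between_mono: "path_between E u p v \<Longrightarrow> E \<subseteq> E' \<Longrightarrow> path_between E' u p v"
  unfolding path_between_def by (auto elim: successively_mono)

lemma path_between_image:
  assumes "path_between E u p v" "inj_on f (set p)"
  shows "path_between ((`) f ` E) (f u) (map f p) (f v)"
proof -
  have "successively (\<lambda>a b. {a, b} \<in> (`) f ` E) (map f p)"
    unfolding successively_map
  proof (rule successively_mono)
    show "successively (\<lambda>a b. {a, b} \<in> E) p" using assms(1) by (simp add: path_between_def)
    show "{f a, f b} \<in> (`) f ` E" if "{a, b} \<in> E" for a b
      using imageI[OF that, of "(`) f"] by simp
  qed
  then show ?thesis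
    using assms by (auto simp: path_between_def hd_map last_map distinct_map)
qed

text \<open>Cuts are transported by preimage and, since \<open>f\<close> is injective on \<open>V\<close>, by image.\<close>

lemma cut_tree_image:
  assumes "inj_on f V" "\<And>e. e \<in> E \<Longrightarrow> e \<subseteq> V"
  shows "cut_tree (f ` V) ((`) f ` E) \<longleftrightarrow> cut_tree V E"
proof -
  have inv: "f -` f ` (S \<inter> V) \<inter> A = S \<inter> A" if "A \<subseteq> V" for S A
    using assms(1) that by (auto simp: inj_on_def)
  have eqS: "splits (f ` (S \<inter> V)) (f ` A) \<longleftrightarrow> splits S A" if "A \<subseteq> V" for S A
    unfolding splits_vimage by (rule splits_cong) (use inv[OF that] in blast)
  have inje: "f ` e = f ` e' \<longleftrightarrow> e = e'" if "e \<in> E" "e' \<in> E" for e e'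
    using assms that by (auto simp: inj_on_image_eq_iff)
  have 1: "simple_graph (f ` V) ((`) f ` E) \<longleftrightarrow> simple_graph V E"
    unfolding simple_graph_def using assms
    by (auto simp: finite_image_iff card_image inj_on_subset)
  have 2: "(\<forall>S. splits S (f ` V) \<longrightarrow> (\<exists>e\<in>(`) f ` E. splits S e)) \<longleftrightarrow>
           (\<forall>S. splits S V \<longrightarrow> (\<exists>e\<in>E. splits S e))" (is "?L \<longleftrightarrow> ?R")
  proof
    assume L: ?L
    show ?R
    proof (intro allI impI)
      fix S assume "splits S V"
      then have "splits (f ` (S \<inter> V)) (f ` V)" by (simp add: eqS)
      with L obtain e where "e \<in> E" "splits (f ` (S \<inter> V)) (f ` e)" by blast
      then show "\<exists>e\<in>E. splits S e" using eqS assms(2) by blast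
    qed
  qed (auto simp: splits_vimage)
  have 3: "(\<exists>S. \<forall>e'\<in>(`) f ` E. splits S e' \<longleftrightarrow> e' = f ` e) \<longleftrightarrow>
           (\<exists>S. \<forall>e'\<in>E. splits S e' \<longleftrightarrow> e' = e)" (is "?L \<longleftrightarrow> ?R") if e: "e \<in> E" for e
  proof
    assume ?L
    then obtain S where "\<forall>e'\<in>(`) f ` E. splits S e' \<longleftrightarrow> e' = f ` e" by blast
    then have "\<forall>e'\<in>E. splits (f -` S) e' \<longleftrightarrow> e' = e" using inje e by (auto simp: splits_vimage)
    then show ?R by blast
  next
    assume ?R
    then obtain S where "\<forall>e'\<in>E. splits S e' \<longleftrightarrow> e' = e" by blast
    then have "\<forall>e'\<in>(`) f ` E. splits (f ` (S \<inter> V)) e' \<longleftrightarrow> e' = f ` e"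
      using inje e eqS assms(2) by auto
    then show ?L by blast
  qed
  show ?thesis unfolding cut_tree_def 1 2 using 3 by auto
qed

lemma cut_tree_edge: "u \<noteq> v \<Longrightarrow> cut_tree {u, v} {{u, v}}"
  by (auto simp: cut_tree_def simple_graph_def splits_pair intro!: exI[of _ "{u}"])

text \<open>A cut of one part extends to the whole by placing the other part entirely on the side of the
  common node \<open>c\<close>; then no edge of the other part crosses it.\<close>

lemma cut_tree_glue:
  assumes V: "V1 \<inter> V2 = {c}" and E1: "\<And>e. e \<in> E1 \<Longrightarrow> e \<subseteq> V1" and E2: "\<And>e. e \<in> E2 \<Longrightarrow> e \<subseteq> V2"
  shows "cut_tree (V1 \<union> V2) (E1 \<union> E2) \<longleftrightarrow> cut_tree V1 E1 \<and> cut_tree V2 E2"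
proof
  have part: "cut_tree V1 E1"
    if V: "V1 \<inter> V2 = {c}" and E1: "\<And>e. e \<in> E1 \<Longrightarrow> e \<subseteq> V1" and E2: "\<And>e. e \<in> E2 \<Longrightarrow> e \<subseteq> V2"
      and t: "cut_tree (V1 \<union> V2) (E1 \<union> E2)" for V1 V2 :: "'a set" and E1 E2
    unfolding cut_tree_def
  proof (intro conjI allI impI)
    show "simple_graph V1 E1" using t E1 by (auto simp: cut_tree_def simple_graph_def)
    show "V1 \<noteq> {}" using V by blast
    show "\<forall>e\<in>E1. \<exists>S. \<forall>e'\<in>E1. splits S e' = (e' = e)"
    proof
      fix e assume "e \<in> E1"
      then obtain S where "\<And>e'. e' \<in> E1 \<union> E2 \<Longrightarrow> splits S e' \<longleftrightarrow> e' = e"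
        using cut_tree_bridge[OF t, of e] by auto
      then show "\<exists>S. \<forall>e'\<in>E1. splits S e' = (e' = e)" by auto
    qed
    fix S assume S: "splits S V1"
    define S' where "S' = (S \<inter> V1) \<union> (if c \<in> S then V2 else {})"
    have S'V1: "A \<inter> S' = A \<inter> S" if "A \<subseteq> V1" for A using that V by (auto simp: S'_def)
    have "V1 \<inter> S' = V1 \<inter> S" using S'V1 by blast
    then have "splits S' (V1 \<union> V2)" using S by (auto simp: splits_def)
    then obtain e where e: "e \<in> E1 \<union> E2" "splits S' e"
      using cut_tree_connected[OF t] by blast
    have "\<not> splits S' A" if "A \<subseteq> V2" for A using that V by (auto simp: S'_def splits_def)
    then have "e \<in> E1" using e E2 by blast
    moreover have "splits S e" using splits_cong[OF S'V1[OF E1]] e calculation by blast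
    ultimately show "\<exists>e\<in>E1. splits S e" by blast
  qed
  {
    assume t: "cut_tree (V1 \<union> V2) (E1 \<union> E2)"
    show "cut_tree V1 E1 \<and> cut_tree V2 E2"
      using part[of V1 V2 E1 E2] part[of V2 V1 E2 E1] t V E1 E2 by (auto simp: Un_commute Int_commute)
  }
  assume t: "cut_tree V1 E1 \<and> cut_tree V2 E2"
  have bridge: "\<exists>S. \<forall>e'\<in>E1 \<union> E2. splits S e' \<longleftrightarrow> e' = e"
    if V: "V1 \<inter> V2 = {c}" and E1: "\<And>e. e \<in> E1 \<Longrightarrow> e \<subseteq> V1" and E2: "\<And>e. e \<in> E2 \<Longrightarrow> e \<subseteq> V2"
      and t: "cut_tree V1 E1" and e: "e \<in> E1" for V1 V2 :: "'a set" and E1 E2 e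
  proof -
    obtain S where S: "\<And>e'. e'\<in>E1 \<Longrightarrow> splits S e' \<longleftrightarrow> e' = e"
      using cut_tree_bridge[OF t e] by auto
    define S' where "S' = (S \<inter> V1) \<union> (if c \<in> S then V2 else {})"
    have S'V1: "A \<inter> S' = A \<inter> S" if "A \<subseteq> V1" for A using that V by (auto simp: S'_def)
    have 1: "splits S' e' \<longleftrightarrow> e' = e" if "e' \<in> E1" for e'
      using splits_cong[OF S'V1[OF E1]] S that by blast
    have 2: "\<not> splits S' A" if "A \<subseteq> V2" for A using that V by (auto simp: S'_def splits_def)
    have "splits S' e' \<longleftrightarrow> e' = e" if "e' \<in> E1 \<union> E2" for e'
      using 1[of e'] 1[OF e] 2[of e'] E2[of e'] that by auto
    then show ?thesis by blast
  qed
  show "cut_tree (V1 \<union> V2) (E1 \<union> E2)"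
    unfolding cut_tree_def
  proof (intro conjI allI impI ballI)
    show "simple_graph (V1 \<union> V2) (E1 \<union> E2)" using t by (auto simp: cut_tree_def simple_graph_def)
    show "V1 \<union> V2 \<noteq> {}" using V by blast
    show "\<exists>e\<in>E1 \<union> E2. splits S e" if "splits S (V1 \<union> V2)" for S
    proof -
      have "splits S V1 \<or> splits S V2" using that V by (auto simp: splits_def)
      then show ?thesis using t cut_tree_connected[of V1 E1 S] cut_tree_connected[of V2 E2 S] by blast
    qed
    show "\<exists>S. \<forall>e'\<in>E1 \<union> E2. splits S e' \<longleftrightarrow> e' = e" if "e \<in> E1 \<union> E2" for e
      using that bridge[of V1 V2 E1 E2 e] bridge[of V2 V1 E2 E1 e] V E1 E2 t
      by (auto simp: Un_commute Int_commute)
  qed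
qed

section \<open>Chords of the circle\<close>

text \<open>Twice the signed area of the triangle \<open>p q r\<close>: positive iff \<open>p\<close>, \<open>q\<close>, \<open>r\<close> are in counterclockwise order,
  zero iff they are collinear.\<close>

definition orient :: "complex \<Rightarrow> complex \<Rightarrow> complex \<Rightarrow> real" where
  "orient p q r = Im (cnj (q - p) * (r - p))"

lemma orient_same [simp]: "orient p q p = 0" "orient p q q = 0" "orient p p q = 0"
  by (simp_all add: orient_def algebra_simps)

lemma orient_swap: "orient p r q = - orient p q r"
  by (simp add: orient_def algebra_simps)

lemma orient_rotate: "orient q r p = orient p q r"
  by (simp add: orient_def algebra_simps)

lemma orient_segment:
  "orient p q ((1 - u) *\<^sub>R r + u *\<^sub>R s) = (1 - u) * orient p q r + u * orient p q s"
  by (simp add: orient_def algebra_simps)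

text \<open>In this product each factor is positive when \<open>a < b < c < a + 2 * pi\<close>, which is the
  counterclockwise order of the three points.\<close>

lemma orient_cis:
  "orient (cis a) (cis b) (cis c) = 4 * sin ((b - a) / 2) * sin ((c - b) / 2) * sin ((c - a) / 2)"
proof -
  define u v where "u = (b - a) / 2" and "v = (c - b) / 2"
  have uv: "b = a + 2 * u" "c = b + 2 * v" by (simp_all add: u_def v_def field_simps)
  have "orient (cis a) (cis b) (cis c) = sin (c - b) + sin (b - a) - sin (c - a)"
    by (simp add: orient_def sin_diff algebra_simps)
  also have "\<dots> = sin (2 * v) + sin (2 * u) - sin (2 * (u + v))"
    by (simp add: uv algebra_simps)
  also have "\<dots> = 4 * sin u * sin v * sin (u + v)"
  proof -
    have "sin u * sin u + cos u * cos u = 1" "sin v * sin v + cos v * cos v = 1"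
      using sin_cos_squared_add[of u] sin_cos_squared_add[of v] by (simp_all add: power2_eq_square)
    then show ?thesis unfolding sin_double sin_add cos_add by algebra
  qed
  also have "u + v = (c - a) / 2" by (simp add: u_def v_def field_simps)
  finally show ?thesis by (simp add: u_def v_def)
qed

lemma orient_circle_point_pos:
  assumes "a < b" "b < c" "c \<le> n"
  shows "orient (circle_point n a) (circle_point n b) (circle_point n c) > 0"
proof -
  have pos: "sin ((2 * pi * real j / real (n + 1) - 2 * pi * real i / real (n + 1)) / 2) > 0"
    if "i < j" "j \<le> n" for i j
  proof (rule sin_gt_zero)
    have eq: "(2 * pi * real j / real (n + 1) - 2 * pi * real i / real (n + 1)) / 2 =
        pi * (real (j - i) / real (n + 1))"
      using that by (simp add: of_nat_diff diff_divide_distrib right_diff_distrib del: of_nat_add of_nat_Suc)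
    show "0 < (2 * pi * real j / real (n + 1) - 2 * pi * real i / real (n + 1)) / 2"
      unfolding eq using that by simp
    have "real (j - i) / real (n + 1) < 1" using that by (simp add: field_simps)
    then show "(2 * pi * real j / real (n + 1) - 2 * pi * real i / real (n + 1)) / 2 < pi"
      unfolding eq using mult_strict_left_mono[of "real (j - i) / real (n + 1)" 1 pi] by simp
  qed
  show ?thesis
    unfolding circle_point_def orient_cis using pos assms by (simp del: of_nat_add of_nat_Suc)
qed

lemma orient_chord:
  assumes "a < b" "b \<le> n" "k \<le> n"
  shows "orient (circle_point n a) (circle_point n b) (circle_point n k) < 0 \<longleftrightarrow> a < k \<and> k < b"
    and "orient (circle_point n a) (circle_point n b) (circle_point n k) > 0 \<longleftrightarrow> k < a \<or> b < k"
proof -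
  let ?p = "circle_point n"
  consider "k < a" | "k = a" | "a < k" "k < b" | "k = b" | "b < k" by linarith
  then have "(orient (?p a) (?p b) (?p k) < 0 \<longleftrightarrow> a < k \<and> k < b) \<and>
        (orient (?p a) (?p b) (?p k) > 0 \<longleftrightarrow> k < a \<or> b < k)"
  proof cases
    case 1
    then show ?thesis
      using orient_circle_point_pos[of k a b n] assms by (simp add: orient_rotate)
  next
    case 3
    then show ?thesis
      using orient_circle_point_pos[of a k b n] assms orient_swap[of "?p a" "?p k" "?p b"] by simp
  next
    case 5
    then show ?thesis using orient_circle_point_pos[of a b k n] assms by simp
  qed (use assms in simp_all)
  then show "orient (?p a) (?p b) (?p k) < 0 \<longleftrightarrow> a < k \<and> k < b"
    "orient (?p a) (?p b) (?p k) > 0 \<longleftrightarrow> k < a \<or> b < k" by blast+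
qed

lemma open_segment_orient:
  assumes "x \<in> open_segment p q"
  shows "orient p q x = 0"
    and "\<exists>u. 0 < u \<and> u < 1 \<and> orient r s x = (1 - u) * orient r s p + u * orient r s q"
proof -
  obtain u where u: "0 < u" "u < 1" "x = (1 - u) *\<^sub>R p + u *\<^sub>R q"
    using assms by (auto simp: in_segment)
  show "orient p q x = 0" unfolding u(3) orient_segment by simp
  show "\<exists>u. 0 < u \<and> u < 1 \<and> orient r s x = (1 - u) * orient r s p + u * orient r s q"
    using u orient_segment by blast
qed

text \<open>Four points \<open>A\<close>, \<open>B\<close>, \<open>C\<close>, \<open>D\<close> of the plane satisfy
  \<open>[BCD] A + [ABD] C = [ACD] B + [ABC] D\<close>, where the brackets are signed triangle areas, and the
  weights on the two sides have the same sum.  For points in circular order all weights are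
  positive, so after division by that sum both sides are a point of both chords.\<close>

lemma crossing_chords_meet:
  assumes "a < b" "b < c" "c < d" "d \<le> n"
  shows "open_segment (circle_point n a) (circle_point n c) \<inter>
         open_segment (circle_point n b) (circle_point n d) \<noteq> {}"
proof -
  let ?p = "circle_point n"
  define A B C D where "A = ?p a" and "B = ?p b" and "C = ?p c" and "D = ?p d"
  have pos: "orient B C D > 0" "orient A C D > 0" "orient A B D > 0" "orient A B C > 0"
    using assms by (auto simp: A_def B_def C_def D_def intro!: orient_circle_point_pos)
  define w where "w = orient B C D + orient A B D"
  have w: "w = orient A C D + orient A B C" "w > 0"
    using pos by (simp_all add: w_def, simp add: orient_def algebra_simps)
  define s t where "s = orient A B D / w" and "t = orient A B C / w"
  have ne: "A \<noteq> C" "B \<noteq> D" using pos by auto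
  have s: "0 < s" "s < 1" "1 - s = orient B C D / w"
    using pos w by (auto simp: s_def w_def field_simps)
  have t: "0 < t" "t < 1" "1 - t = orient A C D / w"
    using pos w by (auto simp: t_def field_simps)
  have "orient B C D *\<^sub>R A + orient A B D *\<^sub>R C = orient A C D *\<^sub>R B + orient A B C *\<^sub>R D"
    by (simp add: complex_eq_iff orient_def algebra_simps)
  then have "(1 / w) *\<^sub>R (orient B C D *\<^sub>R A + orient A B D *\<^sub>R C) =
      (1 / w) *\<^sub>R (orient A C D *\<^sub>R B + orient A B C *\<^sub>R D)"
    by simp
  then have "(1 - s) *\<^sub>R A + s *\<^sub>R C = (1 - t) *\<^sub>R B + t *\<^sub>R D"
    unfolding s(3) t(3) by (simp add: s_def t_def scaleR_add_right divide_inverse mult.commute)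
  then have "(1 - s) *\<^sub>R A + s *\<^sub>R C \<in> open_segment A C \<inter> open_segment B D"
    using s t ne unfolding Int_iff in_segment by blast
  then show ?thesis unfolding A_def B_def C_def D_def by blast
qed

lemma uncrossed_chords_disjoint:
  assumes "a < b" "b \<le> n" "c < d" "d \<le> n" "(a, b) \<noteq> (c, d)"
    and "\<not> (a < c \<and> c < b \<and> b < d)" "\<not> (c < a \<and> a < d \<and> d < b)"
  shows "open_segment (circle_point n a) (circle_point n b) \<inter>
         open_segment (circle_point n c) (circle_point n d) = {}"
proof (rule ccontr)
  let ?p = "circle_point n"
  define f where "f = orient (?p a) (?p b)"
  assume "\<not> ?thesis"
  then obtain x where x: "x \<in> open_segment (?p a) (?p b)" "x \<in> open_segment (?p c) (?p d)" by blast
  then obtain u where u: "0 < u" "u < 1" "f x = (1 - u) * f (?p c) + u * f (?p d)"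
    using open_segment_orient(2) unfolding f_def by blast
  have "f x = 0" using open_segment_orient(1)[OF x(1)] by (simp add: f_def)
  have neg: "f (?p k) < 0 \<longleftrightarrow> a < k \<and> k < b" and pos: "f (?p k) > 0 \<longleftrightarrow> k < a \<or> b < k"
    if "k \<le> n" for k using orient_chord[OF assms(1,2) that] by (simp_all add: f_def)
  have cn: "c \<le> n" using assms by simp
  \<comment> \<open>Both ends of the second chord lie weakly on one side of the line through the first,
    and not both of them on that line.\<close>
  have "(f (?p c) \<le> 0 \<and> f (?p d) \<le> 0 \<and> (f (?p c) < 0 \<or> f (?p d) < 0)) \<or>
        (f (?p c) \<ge> 0 \<and> f (?p d) \<ge> 0 \<and> (f (?p c) > 0 \<or> f (?p d) > 0))"
    using assms unfolding not_less[symmetric] neg[OF cn] pos[OF cn] neg[OF assms(4)] pos[OF assms(4)]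
    by auto
  then show False
  proof (elim disjE conjE)
    assume "f (?p c) \<le> 0" "f (?p d) \<le> 0" "f (?p c) < 0"
    then have "(1 - u) * f (?p c) < 0" "u * f (?p d) \<le> 0"
      using u by (auto simp: mult_pos_neg mult_nonneg_nonpos)
    then show False using u(3) \<open>f x = 0\<close> by linarith
  next
    assume "f (?p c) \<le> 0" "f (?p d) \<le> 0" "f (?p d) < 0"
    then have "(1 - u) * f (?p c) \<le> 0" "u * f (?p d) < 0"
      using u by (auto simp: mult_pos_neg mult_nonneg_nonpos)
    then show False using u(3) \<open>f x = 0\<close> by linarith
  next
    assume "f (?p c) \<ge> 0" "f (?p d) \<ge> 0" "f (?p c) > 0"
    then have "(1 - u) * f (?p c) > 0" "u * f (?p d) \<ge> 0" using u by auto
    then show False using u(3) \<open>f x = 0\<close> by linarith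
  next
    assume "f (?p c) \<ge> 0" "f (?p d) \<ge> 0" "f (?p d) > 0"
    then have "(1 - u) * f (?p c) \<ge> 0" "u * f (?p d) > 0" using u by auto
    then show False using u(3) \<open>f x = 0\<close> by linarith
  qed
qed

text \<open>Two chords cross iff their ends alternate around the circle.\<close>

definition crossing_free :: "nat set set \<Rightarrow> bool" where
  "crossing_free E \<longleftrightarrow> (\<forall>a b c d. a < b \<longrightarrow> b < c \<longrightarrow> c < d \<longrightarrow> \<not> ({a, c} \<in> E \<and> {b, d} \<in> E))"

lemma noncrossing_iff_crossing_free:
  assumes "simple_graph {0..n} E"
  shows "noncrossing n E \<longleftrightarrow> crossing_free E"
proof
  have E: "a \<noteq> b \<and> a \<le> n \<and> b \<le> n" if "{a, b} \<in> E" for a b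
    using assms that by (fastforce simp: simple_graph_def)
  show "crossing_free E" if nc: "noncrossing n E"
    unfolding crossing_free_def
  proof (intro allI impI notI)
    fix a b c d :: nat assume *: "a < b" "b < c" "c < d" "{a, c} \<in> E \<and> {b, d} \<in> E"
    then have "{a, c} \<noteq> {b, d}" by (auto simp: doubleton_eq_iff)
    with nc * have "open_segment (circle_point n a) (circle_point n c) \<inter>
        open_segment (circle_point n b) (circle_point n d) = {}"
      unfolding noncrossing_def by blast
    with crossing_chords_meet[of a b c d n] * E show False by blast
  qed
  assume cf: "crossing_free E"
  have *: "open_segment (circle_point n a) (circle_point n b) \<inter>
         open_segment (circle_point n c) (circle_point n d) = {}"
    if "{a, b} \<in> E" "{c, d} \<in> E" "{a, b} \<noteq> {c, d}" "a < b" "c < d" for a b c d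
  proof (rule uncrossed_chords_disjoint)
    show "(a, b) \<noteq> (c, d)" using that by auto
    show "\<not> (a < c \<and> c < b \<and> b < d)" "\<not> (c < a \<and> a < d \<and> d < b)"
      using cf that unfolding crossing_free_def by blast+
  qed (use that E in auto)
  show "noncrossing n E"
    unfolding noncrossing_def
  proof (intro allI impI)
    fix a b c d assume ab: "{a, b} \<in> E" and cd: "{c, d} \<in> E" and ne: "{a, b} \<noteq> {c, d}"
    from E[OF ab] E[OF cd] consider "a < b" "c < d" | "a < b" "d < c" | "b < a" "c < d" | "b < a" "d < c"
      by linarith
    then show "open_segment (circle_point n a) (circle_point n b) \<inter>
         open_segment (circle_point n c) (circle_point n d) = {}"
    proof cases
      case 1 then show ?thesis using *[of a b c d] ab cd ne by blast
    next
      case 2 then show ?thesis using *[of a b d c] ab cd ne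
        by (simp add: insert_commute open_segment_commute)
    next
      case 3 then show ?thesis using *[of b a c d] ab cd ne
        by (simp add: insert_commute open_segment_commute)
    next
      case 4 then show ?thesis using *[of b a d c] ab cd ne
        by (simp add: insert_commute open_segment_commute)
    qed
  qed
qed

section \<open>Noncrossing trees and relabelling\<close>

lemma noncrossing_trees_iff: "E \<in> noncrossing_trees n \<longleftrightarrow> cut_tree {0..n} E \<and> crossing_free E"
  unfolding noncrossing_trees_def
  using noncrossing_iff_crossing_free[of n E] graph_tree_iff_cut_tree[of "{0..n}" E]
  by (auto simp: graph_tree_def)

lemma cut_tree_edgeD: "cut_tree V E \<Longrightarrow> e \<in> E \<Longrightarrow> e \<subseteq> V \<and> card e = 2"
  by (simp add: cut_tree_def simple_graph_def)

lemma noncrossing_trees_subset: "E \<in> noncrossing_trees n \<Longrightarrow> E \<subseteq> Pow {0..n}"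
  using cut_tree_edgeD by (fastforce simp: noncrossing_trees_iff)

lemma finite_noncrossing_trees [simp]: "finite (noncrossing_trees n)"
  by (rule finite_subset[of _ "Pow (Pow {0..n})"]) (use noncrossing_trees_subset in auto)

lemma noncrossing_trees_0: "noncrossing_trees 0 = {{}}"
proof -
  have *: "cut_tree {0} E \<longleftrightarrow> E = {}" for E :: "nat set set"
  proof
    assume "cut_tree {0} E"
    then have "e \<subseteq> {0} \<and> card e = 2" if "e \<in> E" for e using cut_tree_edgeD that by blast
    moreover have "card e \<noteq> 2" if "e \<subseteq> {0}" for e :: "nat set"
      using card_mono[OF _ that] by simp
    ultimately have "e \<notin> E" for e by metis
    then show "E = {}" by auto
  next
    assume "E = {}"
    then show "cut_tree {0} E" by (auto simp: cut_tree_def simple_graph_def splits_def)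
  qed
  have "crossing_free {}" by (simp add: crossing_free_def)
  then have "E \<in> noncrossing_trees 0 \<longleftrightarrow> E = {}" for E
    unfolding noncrossing_trees_iff atLeastAtMost_singleton * by blast
  then show ?thesis by blast
qed

definition edge_trees :: "nat \<Rightarrow> nat set set set" where
  "edge_trees n = {E \<in> noncrossing_trees n. {0, n} \<in> E}"

lemma finite_edge_trees [simp]: "finite (edge_trees n)"
  by (simp add: edge_trees_def)

lemma edge_trees_0 [simp]: "edge_trees 0 = {}"
  by (simp add: edge_trees_def noncrossing_trees_0)

lemma crossing_freeD:
  "crossing_free E \<Longrightarrow> {a, c} \<in> E \<Longrightarrow> {b, d} \<in> E \<Longrightarrow> a < b \<Longrightarrow> b < c \<Longrightarrow> c < d \<Longrightarrow> False"
  by (simp add: crossing_free_def)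

lemma crossing_free_subset: "crossing_free E \<Longrightarrow> E' \<subseteq> E \<Longrightarrow> crossing_free E'"
  unfolding crossing_free_def by blast

lemma crossing_free_Un:
  assumes "E1 \<subseteq> Pow {..m}" "E2 \<subseteq> Pow {m..}"
  shows "crossing_free (E1 \<union> E2) \<longleftrightarrow> crossing_free E1 \<and> crossing_free E2"
proof
  assume cf: "crossing_free E1 \<and> crossing_free E2"
  have 1: "p \<le> m \<and> q \<le> m" if "{p, q} \<in> E1" for p q using assms(1) that by auto
  have 2: "p \<ge> m \<and> q \<ge> m" if "{p, q} \<in> E2" for p q using assms(2) that by auto
  show "crossing_free (E1 \<union> E2)"
    unfolding crossing_free_def
  proof (intro allI impI notI)
    fix a b c d :: nat assume *: "a < b" "b < c" "c < d" "{a, c} \<in> E1 \<union> E2 \<and> {b, d} \<in> E1 \<union> E2"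
    have "\<not> ({a, c} \<in> E1 \<and> {b, d} \<in> E2)" "\<not> ({a, c} \<in> E2 \<and> {b, d} \<in> E1)"
      using 1 2 *(1-3) by fastforce+
    then have "{a, c} \<in> E1 \<and> {b, d} \<in> E1 \<or> {a, c} \<in> E2 \<and> {b, d} \<in> E2" using *(4) by blast
    then show False using cf crossing_freeD *(1-3) by blast
  qed
qed (use crossing_free_subset in blast)

lemma crossing_free_insert_outer:
  assumes "E \<subseteq> Pow {0..n}"
  shows "crossing_free (insert {0, n} E) \<longleftrightarrow> crossing_free E"
proof
  assume cf: "crossing_free E"
  have le: "p \<le> n \<and> q \<le> n" if "{p, q} \<in> insert {0, n} E" for p q
    using assms that by (auto simp: doubleton_eq_iff)
  show "crossing_free (insert {0, n} E)"
    unfolding crossing_free_def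
  proof (intro allI impI notI)
    fix a b c d :: nat
    assume *: "a < b" "b < c" "c < d" "{a, c} \<in> insert {0, n} E \<and> {b, d} \<in> insert {0, n} E"
    then have "d \<le> n" using le[of b d] by simp
    with * have "{a, c} \<noteq> {0, n}" "{b, d} \<noteq> {0, n}" by (auto simp: doubleton_eq_iff)
    then have "{a, c} \<in> E" "{b, d} \<in> E" using *(4) by simp_all
    then show False using crossing_freeD[OF cf] *(1-3) by blast
  qed
qed (use crossing_free_subset in blast)

lemma edge_image_iff:
  assumes "inj_on f V" "E \<subseteq> Pow V" "p \<in> V" "q \<in> V"
  shows "{f p, f q} \<in> (`) f ` E \<longleftrightarrow> {p, q} \<in> E"
proof
  assume "{f p, f q} \<in> (`) f ` E"
  then obtain e where e: "e \<in> E" "f ` e = f ` {p, q}" by auto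
  then have "e = {p, q}" using assms by (subst (asm) inj_on_image_eq_iff[of f V]) auto
  with e show "{p, q} \<in> E" by simp
next
  assume "{p, q} \<in> E"
  then show "{f p, f q} \<in> (`) f ` E" using imageI[of "{p, q}" E "(`) f"] by simp
qed

lemma crossing_free_image:
  assumes "inj_on f V" "E \<subseteq> Pow V"
  shows "crossing_free ((`) f ` E) \<longleftrightarrow>
    (\<forall>p\<in>V. \<forall>q\<in>V. \<forall>r\<in>V. \<forall>s\<in>V. f p < f q \<longrightarrow> f q < f r \<longrightarrow> f r < f s \<longrightarrow> \<not> ({p, r} \<in> E \<and> {q, s} \<in> E))"
    (is "_ \<longleftrightarrow> ?R")
proof
  assume cf: "crossing_free ((`) f ` E)"
  show ?R
  proof (intro ballI impI notI)
    fix p q r s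
    assume "p \<in> V" "q \<in> V" "r \<in> V" "s \<in> V" and lt: "f p < f q" "f q < f r" "f r < f s"
      and "{p, r} \<in> E \<and> {q, s} \<in> E"
    then have "{f p, f r} \<in> (`) f ` E" "{f q, f s} \<in> (`) f ` E"
      by (simp_all add: edge_image_iff[OF assms])
    then show False using crossing_freeD[OF cf] lt by blast
  qed
next
  assume R: ?R
  show "crossing_free ((`) f ` E)"
    unfolding crossing_free_def
  proof (intro allI impI notI)
    fix a b c d assume *: "a < b" "b < c" "c < d" "{a, c} \<in> (`) f ` E \<and> {b, d} \<in> (`) f ` E"
    then have "{a, c} \<subseteq> f ` V" "{b, d} \<subseteq> f ` V" using assms(2) by blast+
    then obtain p q r s where "p \<in> V" "q \<in> V" "r \<in> V" "s \<in> V" "a = f p" "b = f q" "c = f r" "d = f s"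
      by auto
    with * R show False using edge_image_iff[OF assms] by metis
  qed
qed

section \<open>Splitting off the part beyond the last neighbour of the root\<close>

lemma image_add_interval: "(+) c ` {0..m} = {c..c + m}" for c m :: nat
  by simp

lemma shifted_tree_iff:
  assumes "E \<subseteq> Pow {0..m}"
  shows "cut_tree {c..c + m} ((`) ((+) c) ` E) \<and> crossing_free ((`) ((+) c) ` E) \<longleftrightarrow> E \<in> noncrossing_trees m"
proof -
  have inj: "inj_on ((+) c) {0..m}" by simp
  have "crossing_free ((`) ((+) c) ` E) \<longleftrightarrow> crossing_free E"
  proof
    assume "crossing_free ((`) ((+) c) ` E)"
    then have R: "\<forall>p\<in>{0..m}. \<forall>q\<in>{0..m}. \<forall>r\<in>{0..m}. \<forall>s\<in>{0..m}. p < q \<longrightarrow> q < r \<longrightarrow> r < s \<longrightarrow> \<not> ({p, r} \<in> E \<and> {q, s} \<in> E)"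
      using crossing_free_image[OF inj assms] by simp
    show "crossing_free E"
      unfolding crossing_free_def
    proof (intro allI impI notI)
      fix p q r s :: nat
      assume *: "p < q" "q < r" "r < s" "{p, r} \<in> E \<and> {q, s} \<in> E"
      then have "{p, r} \<subseteq> {0..m}" "{q, s} \<subseteq> {0..m}" using assms by blast+
      then show False using R[rule_format, of p q r s] * by simp
    qed
  next
    assume cf: "crossing_free E"
    show "crossing_free ((`) ((+) c) ` E)"
      unfolding crossing_free_image[OF inj assms] by (simp, blast dest: crossing_freeD[OF cf])
  qed
  moreover have "cut_tree {c..c + m} ((`) ((+) c) ` E) \<longleftrightarrow> cut_tree {0..m} E"
    using cut_tree_image[OF inj, of E] assms by (simp add: add.commute subset_iff)
  ultimately show ?thesis by (simp add: noncrossing_trees_iff)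
qed

text \<open>A tree on \<open>{0..c}\<close> and one on \<open>{c..n}\<close> share only the node \<open>c\<close>; their edges lie on the two sides of \<open>c\<close>
  and cannot cross.\<close>

lemma glue_at_vertex_iff:
  assumes "c \<le> n" "E1 \<subseteq> Pow {0..c}" "E2 \<subseteq> Pow {0..n - c}"
  shows "E1 \<union> (`) ((+) c) ` E2 \<in> noncrossing_trees n \<longleftrightarrow>
    E1 \<in> noncrossing_trees c \<and> E2 \<in> noncrossing_trees (n - c)"
proof -
  let ?E2 = "(`) ((+) c) ` E2"
  have s2: "?E2 \<subseteq> Pow {c..n}"
    using image_mono[of _ "{0..n - c}" "(+) c"] assms(1,3) by (fastforce simp: image_add_interval)
  have V: "{0..n} = {0..c} \<union> {c..n}" "{0..c} \<inter> {c..n} = {c}" using assms(1) by auto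
  have "cut_tree {0..n} (E1 \<union> ?E2) \<longleftrightarrow> cut_tree {0..c} E1 \<and> cut_tree {c..n} ?E2"
    unfolding V(1) by (rule cut_tree_glue[OF V(2)]) (use assms(2) s2 in blast)+
  moreover have "crossing_free (E1 \<union> ?E2) \<longleftrightarrow> crossing_free E1 \<and> crossing_free ?E2"
    by (rule crossing_free_Un[of _ c]) (use assms(2) in \<open>simp_all add: atLeast0AtMost image_subset_iff\<close>)
  ultimately show ?thesis
    using shifted_tree_iff[OF assms(3), of c] assms(1) by (auto simp: noncrossing_trees_iff)
qed

lemma subset_image_image: "A \<subseteq> Pow (f ` V) \<Longrightarrow> \<exists>B. B \<subseteq> Pow V \<and> A = (`) f ` B"
  by (metis image_Pow_surj subset_imageE)

lemma inj_on_image_image: "inj_on f V \<Longrightarrow> inj_on ((`) ((`) f)) (Pow (Pow V))"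
  by (intro inj_on_image_Pow)

text \<open>Let \<open>c\<close> be the last neighbour of node \<open>0\<close>.  No edge passes over \<open>c\<close>, so the tree consists of a tree
  on \<open>{0..c}\<close> that contains the edge \<open>{0, c}\<close>, and of an arbitrary tree on \<open>{c..n}\<close>.\<close>

lemma bij_betw_last_neighbour:
  assumes "n \<ge> 1"
  shows "bij_betw (\<lambda>(c, E1, E2). E1 \<union> (`) ((+) c) ` E2)
    (SIGMA c:{1..n}. edge_trees c \<times> noncrossing_trees (n - c)) (noncrossing_trees n)"
  unfolding bij_betw_def
proof
  have facts: "{0, c} \<in> E \<and> (\<forall>k. {0, k} \<in> E \<longrightarrow> k \<le> c) \<and> {e \<in> E. e \<subseteq> {..c}} = E1 \<and>
      {e \<in> E. e \<subseteq> {c..}} = (`) ((+) c) ` E2"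
    if c: "1 \<le> c" "c \<le> n" and E1: "E1 \<in> edge_trees c" and E2: "E2 \<in> noncrossing_trees (n - c)"
      and E: "E = E1 \<union> (`) ((+) c) ` E2" for c E1 E2 E
  proof -
    have E1': "cut_tree {0..c} E1" "{0, c} \<in> E1"
      using E1 by (auto simp: edge_trees_def noncrossing_trees_iff)
    have E2': "cut_tree {c..n} ((`) ((+) c) ` E2)"
      using shifted_tree_iff[OF noncrossing_trees_subset[OF E2], of c] E2 c by simp
    have 1: "e \<subseteq> {..c} \<and> \<not> e \<subseteq> {c..}" if "e \<in> E1" for e
    proof -
      have e: "e \<subseteq> {0..c}" "card e = 2" using cut_tree_edgeD[OF E1'(1) that] by auto
      have "\<not> e \<subseteq> {c}" using card_mono[of "{c}" e] e(2) by auto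
      then show ?thesis using e by fastforce
    qed
    have 2: "e \<subseteq> {c..} \<and> \<not> e \<subseteq> {..c}" if "e \<in> (`) ((+) c) ` E2" for e
    proof -
      have e: "e \<subseteq> {c..n}" "card e = 2" using cut_tree_edgeD[OF E2' that] by auto
      have "\<not> e \<subseteq> {c}" using card_mono[of "{c}" e] e(2) by auto
      then show ?thesis using e by fastforce
    qed
    have "k \<le> c" if "{0, k} \<in> E" for k
      using that 1[of "{0, k}"] 2[of "{0, k}"] c(1) unfolding E by auto
    moreover have "{e \<in> E. e \<subseteq> {..c}} = E1" "{e \<in> E. e \<subseteq> {c..}} = (`) ((+) c) ` E2"
      using 1 2 unfolding E by blast+
    ultimately show ?thesis using E1'(2) E by blast
  qed
  show "inj_on (\<lambda>(c, E1, E2). E1 \<union> (`) ((+) c) ` E2)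
      (SIGMA c:{1..n}. edge_trees c \<times> noncrossing_trees (n - c))"
  proof (rule inj_onI)
    fix u v
    assume u: "u \<in> (SIGMA c:{1..n}. edge_trees c \<times> noncrossing_trees (n - c))"
      and v: "v \<in> (SIGMA c:{1..n}. edge_trees c \<times> noncrossing_trees (n - c))"
      and uv: "(\<lambda>(c, E1, E2). E1 \<union> (`) ((+) c) ` E2) u = (\<lambda>(c, E1, E2). E1 \<union> (`) ((+) c) ` E2) v"
    obtain c E1 E2 c' E1' E2' where u_eq: "u = (c, E1, E2)" and v_eq: "v = (c', E1', E2')"
      by (metis prod_cases3)
    have c: "c \<in> {1..n}" "c' \<in> {1..n}"
      and E: "E1 \<in> edge_trees c" "E2 \<in> noncrossing_trees (n - c)"
        "E1' \<in> edge_trees c'" "E2' \<in> noncrossing_trees (n - c')"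
      and eq: "E1 \<union> (`) ((+) c) ` E2 = E1' \<union> (`) ((+) c') ` E2'"
      using u v uv by (simp_all add: u_eq v_eq)
    define F where "F = E1 \<union> (`) ((+) c) ` E2"
    have f: "{0, c} \<in> F \<and> (\<forall>k. {0, k} \<in> F \<longrightarrow> k \<le> c) \<and> {e \<in> F. e \<subseteq> {..c}} = E1 \<and>
      {e \<in> F. e \<subseteq> {c..}} = (`) ((+) c) ` E2" by (rule facts) (use c E F_def in auto)
    have f': "{0, c'} \<in> F \<and> (\<forall>k. {0, k} \<in> F \<longrightarrow> k \<le> c') \<and> {e \<in> F. e \<subseteq> {..c'}} = E1' \<and>
      {e \<in> F. e \<subseteq> {c'..}} = (`) ((+) c') ` E2'" by (rule facts) (use c E F_def eq in auto)
    have cc: "c = c'" using f f' by (meson le_antisym)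
    then have "(`) ((+) c) ` E2 = (`) ((+) c) ` E2'" "E1 = E1'" using f f' by simp_all
    moreover have "inj ((`) ((`) ((+) c)))" by (simp add: inj_image_eq_iff inj_def)
    ultimately show "u = v" using cc by (auto simp: u_eq v_eq dest: injD)
  qed
  show "(\<lambda>(c, E1, E2). E1 \<union> (`) ((+) c) ` E2) `
      (SIGMA c:{1..n}. edge_trees c \<times> noncrossing_trees (n - c)) = noncrossing_trees n"
  proof (intro equalityI subsetI)
    fix E assume "E \<in> (\<lambda>(c, E1, E2). E1 \<union> (`) ((+) c) ` E2) `
      (SIGMA c:{1..n}. edge_trees c \<times> noncrossing_trees (n - c))"
    then obtain c E1 E2 where c: "c \<le> n" and E: "E1 \<in> noncrossing_trees c" "E2 \<in> noncrossing_trees (n - c)"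
      "E = E1 \<union> (`) ((+) c) ` E2"
      by (auto simp: edge_trees_def)
    then show "E \<in> noncrossing_trees n"
      using glue_at_vertex_iff[OF c noncrossing_trees_subset noncrossing_trees_subset] by blast
  next
    fix E assume E: "E \<in> noncrossing_trees n"
    then have t: "cut_tree {0..n} E" and cf: "crossing_free E" by (simp_all add: noncrossing_trees_iff)
    have le: "k \<le> n" if "{0, k} \<in> E" for k using cut_tree_edgeD[OF t that] by auto
    define K where "K = {k. {0, k} \<in> E}"
    have "splits {0} {0..n}" using assms by (auto simp: splits_def)
    then obtain e where e: "e \<in> E" "splits {0} e" using cut_tree_connected[OF t] by blast
    then obtain a b where "e = {a, b}" using cut_tree_edgeD[OF t e(1)] by (meson card_2_iff)
    then have "K \<noteq> {}" using e by (auto simp: K_def splits_pair insert_commute)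
    moreover have "finite K" by (rule finite_subset[of _ "{..n}"]) (use le in \<open>auto simp: K_def\<close>)
    ultimately have "Max K \<in> K" and max: "\<And>k. k \<in> K \<Longrightarrow> k \<le> Max K" by auto
    define c where "c = Max K"
    have c: "{0, c} \<in> E" using \<open>Max K \<in> K\<close> by (simp add: c_def K_def)
    have cmax: "k \<le> c" if "{0, k} \<in> E" for k using max[of k] that by (simp add: c_def K_def)
    have cn: "c \<le> n" using le[OF c] .
    have "c \<noteq> 0" using cut_tree_edgeD[OF t c] by (cases "c = 0") simp_all
    \<comment> \<open>An edge from below \<open>c\<close> to beyond it would cross \<open>{0, c}\<close> or lead to a later neighbour of \<open>0\<close>.\<close>
    have part: "e \<subseteq> {0..c} \<or> e \<subseteq> {c..n}" if e: "e \<in> E" for e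
    proof -
      have no: "\<not> (i < c \<and> c < j)" if "{i, j} \<in> E" for i j
        using cmax[of j] cf c that unfolding crossing_free_def
        by (metis gr0I insert_commute leD)
      obtain a b where ab: "e = {a, b}" using cut_tree_edgeD[OF t e] by (meson card_2_iff)
      then show ?thesis using no[of a b] no[of b a] e cut_tree_edgeD[OF t e]
        by (auto simp: insert_commute)
    qed
    define E1 where "E1 = {e \<in> E. e \<subseteq> {0..c}}"
    define E2' where "E2' = {e \<in> E. e \<subseteq> {c..n}}"
    have "E2' \<subseteq> Pow ((+) c ` {0..n - c})" using cn by (auto simp: E2'_def)
    from subset_image_image[OF this]
    obtain E2 where E2: "E2 \<subseteq> Pow {0..n - c}" "E2' = (`) ((+) c) ` E2" by blast
    have EE: "E = E1 \<union> (`) ((+) c) ` E2" 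
      unfolding E2(2)[symmetric] E1_def E2'_def using part by blast
    have "E1 \<in> noncrossing_trees c \<and> E2 \<in> noncrossing_trees (n - c)"
      using glue_at_vertex_iff[OF cn _ E2(1), of E1] E unfolding EE by (auto simp: E1_def)
    moreover have "{0, c} \<in> E1" using c by (simp add: E1_def)
    ultimately have "(c, E1, E2) \<in> (SIGMA c:{1..n}. edge_trees c \<times> noncrossing_trees (n - c))"
      using cn \<open>c \<noteq> 0\<close> by (auto simp: edge_trees_def)
    then show "E \<in> (\<lambda>(c, E1, E2). E1 \<union> (`) ((+) c) ` E2) `
      (SIGMA c:{1..n}. edge_trees c \<times> noncrossing_trees (n - c))"
      by (rule rev_image_eqI) (simp add: EE)
  qed
qed

section \<open>Removing the edge between the first and the last node\<close>

text \<open>The numbering of the tree that hangs below the last node \<open>n\<close>: its root \<open>0\<close> becomes \<open>n\<close>, its other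
  nodes follow \<open>a\<close>.  This rotates the nodes, so their cyclic order and hence the crossings stay the
  same, while the distances from \<open>n\<close> are the depths before the renumbering.\<close>

definition wrap :: "nat \<Rightarrow> nat \<Rightarrow> nat \<Rightarrow> nat" where
  "wrap a n i = (if i = 0 then n else a + i)"

lemma inj_on_wrap: "n = a + 1 + m \<Longrightarrow> inj_on (wrap a n) {0..m}"
  by (auto simp: inj_on_def wrap_def split: if_splits)

lemma wrap_image: "n = a + 1 + m \<Longrightarrow> wrap a n ` {0..m} = {a + 1..n}"
proof (intro equalityI subsetI)
  fix x assume n: "n = a + 1 + m" and x: "x \<in> {a + 1..n}"
  show "x \<in> wrap a n ` {0..m}"
  proof (cases "x = n")
    case True
    then have "x = wrap a n 0" by (simp add: wrap_def)
    then show ?thesis by simp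
  next
    case False
    then have "x = wrap a n (x - a)" "x - a \<in> {0..m}" using n x by (auto simp: wrap_def)
    then show ?thesis by blast
  qed
qed (auto simp: wrap_def split: if_splits)

lemma wrapped_tree_iff:
  assumes n: "n = a + 1 + m" and E: "E \<subseteq> Pow {0..m}"
  shows "cut_tree {a + 1..n} ((`) (wrap a n) ` E) \<and> crossing_free ((`) (wrap a n) ` E) \<longleftrightarrow> E \<in> noncrossing_trees m"
proof -
  note inj = inj_on_wrap[OF n]
  have "crossing_free ((`) (wrap a n) ` E) \<longleftrightarrow> crossing_free E"
  proof
    assume "crossing_free ((`) (wrap a n) ` E)"
    note R = this[unfolded crossing_free_image[OF inj E], rule_format]
    show "crossing_free E"
      unfolding crossing_free_def
    proof (intro allI impI notI)
      fix p q r s :: nat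
      assume *: "p < q" "q < r" "r < s" "{p, r} \<in> E \<and> {q, s} \<in> E"
      then have "{p, r} \<subseteq> {0..m}" "{q, s} \<subseteq> {0..m}" using E by blast+
      then have le: "p \<le> m" "q \<le> m" "r \<le> m" "s \<le> m" by simp_all
      show False
      proof (cases "p = 0")
        case True
        \<comment> \<open>The first node \<open>p\<close> becomes the last one.\<close>
        show False using R[of q r s p] * le n True by (simp add: wrap_def insert_commute)
      next
        case False
        show False using R[of p q r s] * le n False by (simp add: wrap_def)
      qed
    qed
  next
    assume cf: "crossing_free E"
    show "crossing_free ((`) (wrap a n) ` E)"
      unfolding crossing_free_image[OF inj E]
    proof (intro ballI impI notI)
      fix p q r s
      assume le: "p \<in> {0..m}" "q \<in> {0..m}" "r \<in> {0..m}" "s \<in> {0..m}"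
        and lt: "wrap a n p < wrap a n q" "wrap a n q < wrap a n r" "wrap a n r < wrap a n s"
        and e: "{p, r} \<in> E \<and> {q, s} \<in> E"
      have "p < q \<and> q < r \<and> (s = 0 \<and> 0 < p \<or> r < s)"
        using le lt n by (auto simp: wrap_def split: if_splits)
      then show False
        using crossing_freeD[OF cf, of s q p r] crossing_freeD[OF cf, of p r q s] e
        by (auto simp: insert_commute)
    qed
  qed
  moreover have "cut_tree {a + 1..n} ((`) (wrap a n) ` E) \<longleftrightarrow> cut_tree {0..m} E"
    using cut_tree_image[OF inj, of E] E unfolding wrap_image[OF n] by (simp add: subset_iff)
  ultimately show ?thesis by (simp add: noncrossing_trees_iff)
qed

text \<open>Joining by an edge is gluing at both ends of the tree that consists of this edge.\<close>

lemma cut_tree_join: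
  assumes V: "V1 \<inter> V2 = {}" "u \<in> V1" "v \<in> V2" and E: "E1 \<subseteq> Pow V1" "E2 \<subseteq> Pow V2"
  shows "cut_tree (V1 \<union> V2) (insert {u, v} (E1 \<union> E2)) \<longleftrightarrow> cut_tree V1 E1 \<and> cut_tree V2 E2"
proof -
  have "u \<noteq> v" using V by blast
  have 1: "cut_tree (V1 \<union> {u, v}) (E1 \<union> {{u, v}}) \<longleftrightarrow> cut_tree V1 E1 \<and> cut_tree {u, v} {{u, v}}"
    by (rule cut_tree_glue[of _ _ u]) (use V E in auto)
  have 2: "cut_tree ((V1 \<union> {u, v}) \<union> V2) ((E1 \<union> {{u, v}}) \<union> E2) \<longleftrightarrow>
      cut_tree (V1 \<union> {u, v}) (E1 \<union> {{u, v}}) \<and> cut_tree V2 E2"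
    by (rule cut_tree_glue[of _ _ v]) (use V E in auto)
  have "(V1 \<union> {u, v}) \<union> V2 = V1 \<union> V2" "(E1 \<union> {{u, v}}) \<union> E2 = insert {u, v} (E1 \<union> E2)"
    using V by auto
  then show ?thesis using 1 2 cut_tree_edge[OF \<open>u \<noteq> v\<close>] by simp
qed

lemma join_by_outer_edge_iff:
  assumes n: "n = a + 1 + m" and E1: "E1 \<subseteq> Pow {0..a}" and E2: "E2 \<subseteq> Pow {0..m}"
  shows "insert {0, n} (E1 \<union> (`) (wrap a n) ` E2) \<in> noncrossing_trees n \<longleftrightarrow>
    E1 \<in> noncrossing_trees a \<and> E2 \<in> noncrossing_trees m"
proof -
  let ?E2 = "(`) (wrap a n) ` E2"
  have s2: "?E2 \<subseteq> Pow {a + 1..n}"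
    unfolding wrap_image[OF n, symmetric] using E2 by auto
  have V: "{0..n} = {0..a} \<union> {a + 1..n}" "{0..a} \<inter> {a + 1..n} = {}" using n by auto
  have "cut_tree {0..n} (insert {0, n} (E1 \<union> ?E2)) \<longleftrightarrow> cut_tree {0..a} E1 \<and> cut_tree {a + 1..n} ?E2"
    unfolding V(1) by (rule cut_tree_join[OF V(2)]) (use n E1 s2 in simp_all)
  moreover have "crossing_free (insert {0, n} (E1 \<union> ?E2)) \<longleftrightarrow> crossing_free E1 \<and> crossing_free ?E2"
  proof -
    have "E1 \<subseteq> Pow {0..n}" "E1 \<subseteq> Pow {..a}"
      by (rule subset_trans[OF E1 Pow_mono], (use n in auto)[1])+
    moreover have "?E2 \<subseteq> Pow {0..n}" "?E2 \<subseteq> Pow {a..}"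
      by (rule subset_trans[OF s2 Pow_mono], (use n in auto)[1])+
    ultimately have "E1 \<union> ?E2 \<subseteq> Pow {0..n}" "E1 \<subseteq> Pow {..a}" "?E2 \<subseteq> Pow {a..}" by simp_all
    then show ?thesis by (simp add: crossing_free_insert_outer crossing_free_Un)
  qed
  ultimately show ?thesis
    using wrapped_tree_iff[OF n E2] by (auto simp: noncrossing_trees_iff)
qed

text \<open>Removing the edge \<open>{0, n}\<close> leaves two trees whose node sets are intervals: if a node before
  \<open>a\<close> belonged to the tree of \<open>n\<close>, where \<open>a\<close> is the last node of the tree of \<open>0\<close>, then the path from
  it to \<open>n\<close> and the path from \<open>0\<close> to \<open>a\<close> would cross.\<close>

lemma outer_edge_sides:
  assumes E: "E \<in> edge_trees n"
  obtains a where "a < n" "\<And>e. e \<in> E \<Longrightarrow> e \<noteq> {0, n} \<Longrightarrow> e \<subseteq> {0..a} \<or> e \<subseteq> {a + 1..n}"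
proof -
  have t: "cut_tree {0..n} E" and cf: "crossing_free E" and e0: "{0, n} \<in> E"
    using E by (auto simp: edge_trees_def noncrossing_trees_iff)
  have e2: "\<exists>u v. e = {u, v} \<and> u \<le> n \<and> v \<le> n" if e: "e \<in> E" for e
  proof -
    obtain u v where "e = {u, v}" using cut_tree_edgeD[OF t e] by (meson card_2_iff)
    then show ?thesis using cut_tree_edgeD[OF t e] by auto
  qed
  obtain S0 where S0: "\<And>e. e \<in> E \<Longrightarrow> splits S0 e \<longleftrightarrow> e = {0, n}"
    using cut_tree_bridge[OF t e0] by auto
  \<comment> \<open>The side of \<open>0\<close> in the cut that only \<open>{0, n}\<close> crosses.\<close>
  define S where "S = (if 0 \<in> S0 then S0 else - S0)"
  have S: "splits S e \<longleftrightarrow> e = {0, n}" if "e \<in> E" for e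
    using S0[OF that] by (simp add: S_def splits_Compl)
  have "0 \<in> S" by (simp add: S_def)
  then have "n \<notin> S" using S[OF e0] by (simp add: splits_pair)
  define a where "a = Max (S \<inter> {0..n})"
  have "a \<in> S \<inter> {0..n}" unfolding a_def by (rule Max_in) (use \<open>0 \<in> S\<close> in auto)
  then have a: "a \<in> S" "a \<le> n" by auto
  with \<open>n \<notin> S\<close> have "a < n" by (cases "a = n") auto
  have amax: "k \<le> a" if "k \<in> S" "k \<le> n" for k
    unfolding a_def by (rule Max_ge) (use that in auto)
  have "i \<in> S" if "i \<le> a" for i
  proof (rule ccontr)
    assume "i \<notin> S"
    then have "i \<noteq> 0" "i \<noteq> a" using \<open>0 \<in> S\<close> a(1) by metis+
    then have i: "0 < i" "i < a" using that by simp_all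
    \<comment> \<open>An edge that leaves the nodes below \<open>a\<close> on the side of \<open>n\<close> leads beyond \<open>a\<close>,
      because \<open>0\<close> and \<open>a\<close> are on the other side.\<close>
    define U where "U = {0<..<a} - S"
    have "i \<in> U" "0 \<notin> U" "i \<le> n" using i \<open>i \<notin> S\<close> a by (simp_all add: U_def)
    then have "splits U {0..n}" by (auto simp: splits_def)
    then obtain e where e: "e \<in> E" "splits U e" using cut_tree_connected[OF t] by blast
    then obtain u v where uv: "e = {u, v}" "u \<in> U" "v \<notin> U" "v \<le> n"
      using e2[OF e(1)] by (metis insert_commute splits_pair)
    have "e \<noteq> {0, n}" using uv \<open>a < n\<close> by (auto simp: U_def doubleton_eq_iff)
    then have "\<not> splits S {u, v}" using S[OF e(1)] uv(1) by simp
    then have vS: "v \<notin> S" using uv(2) by (auto simp: splits_pair U_def)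
    have "v \<noteq> 0" "v \<noteq> a" using vS \<open>0 \<in> S\<close> a by metis+
    then have "a < v" using uv vS by (auto simp: U_def)
    have u: "0 < u" "u < a" "u \<notin> S" using uv(2) by (auto simp: U_def)
    \<comment> \<open>The edge \<open>{u, v}\<close> separates \<open>a\<close> from \<open>0\<close>, which are on the same side \<open>S\<close>.\<close>
    define W where "W = S \<inter> {u<..<v}"
    have "a \<in> W" "0 \<notin> W" using u \<open>a < v\<close> a by (auto simp: W_def)
    then have "splits W {0..n}" using a by (auto simp: splits_def)
    then obtain f where f: "f \<in> E" "splits W f" using cut_tree_connected[OF t] by blast
    then obtain w x where wx: "f = {w, x}" "w \<in> W" "x \<notin> W"
      using e2[OF f(1)] by (metis insert_commute splits_pair)
    have w: "u < w" "w < v" "w \<in> S" using wx(2) by (auto simp: W_def)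
    have "f \<noteq> {0, n}" using w wx(1) uv(4) by (auto simp: doubleton_eq_iff)
    then have "\<not> splits S {w, x}" using S[OF f(1)] wx(1) by simp
    then have "x \<in> S" using w by (simp add: splits_pair)
    then have "x \<noteq> u" "x \<noteq> v" using u vS by auto
    then have "x < u \<or> v < x" using wx(3) \<open>x \<in> S\<close> by (auto simp: W_def)
    moreover have "{u, v} \<in> E" "{w, x} \<in> E" using e f uv wx by simp_all
    ultimately show False
      using crossing_freeD[OF cf, of x w u v] crossing_freeD[OF cf, of u v w x] w
      by (auto simp: insert_commute)
  qed
  then have Sa: "k \<in> S \<longleftrightarrow> k \<le> a" if "k \<le> n" for k using amax that by blast
  have "e \<subseteq> {0..a} \<or> e \<subseteq> {a + 1..n}" if e: "e \<in> E" "e \<noteq> {0, n}" for e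
  proof -
    obtain u v where uv: "e = {u, v}" "u \<le> n" "v \<le> n" using e2[OF e(1)] by blast
    have "u \<in> S \<longleftrightarrow> v \<in> S" using S[OF e(1)] e(2) uv(1) by (simp add: splits_pair)
    then show ?thesis using uv Sa by auto
  qed
  with \<open>a < n\<close> show ?thesis using that by blast
qed

text \<open>Without the edge \<open>{0, n}\<close>, the tree falls into a tree on \<open>{0..a}\<close> and a tree on \<open>{a + 1..n}\<close>.  The
  bound \<open>a\<close> is determined, as the tree with the larger bound would connect nodes that the other
  decomposition keeps apart.\<close>

lemma bij_betw_outer_edge:
  "bij_betw (\<lambda>(a, E1, E2). insert {0, n} (E1 \<union> (`) (wrap a n) ` E2))
    (SIGMA a:{..<n}. noncrossing_trees a \<times> noncrossing_trees (n - 1 - a)) (edge_trees n)"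
  unfolding bij_betw_def
proof
  let ?D = "SIGMA a:{..<n}. noncrossing_trees a \<times> noncrossing_trees (n - 1 - a)"
  let ?f = "\<lambda>(a, E1, E2). insert {0, n} (E1 \<union> (`) (wrap a n) ` E2)"
  have facts: "cut_tree {0..a} E1 \<and> {e \<in> F. e \<subseteq> {0..a}} = E1 \<and>
      {e \<in> F. e \<subseteq> {a + 1..n}} = (`) (wrap a n) ` E2 \<and>
      (\<forall>e\<in>F. e \<noteq> {0, n} \<longrightarrow> e \<subseteq> {0..a} \<or> e \<subseteq> {a + 1..n})"
    if a: "a < n" and E1: "E1 \<in> noncrossing_trees a" and E2: "E2 \<in> noncrossing_trees (n - 1 - a)"
      and F: "F = insert {0, n} (E1 \<union> (`) (wrap a n) ` E2)" for a E1 E2 F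
  proof -
    have n: "n = a + 1 + (n - 1 - a)" using a by simp
    have t1: "cut_tree {0..a} E1" using E1 by (simp add: noncrossing_trees_iff)
    have t2: "cut_tree {a + 1..n} ((`) (wrap a n) ` E2)"
      using wrapped_tree_iff[OF n noncrossing_trees_subset[OF E2]] E2 by blast
    have 1: "e \<subseteq> {0..a} \<and> \<not> e \<subseteq> {a + 1..n}" if "e \<in> E1" for e
    proof -
      have e: "e \<subseteq> {0..a}" "card e = 2" using cut_tree_edgeD[OF t1 that] by auto
      then have "e \<noteq> {}" by auto
      with e show ?thesis by fastforce
    qed
    have 2: "e \<subseteq> {a + 1..n} \<and> \<not> e \<subseteq> {0..a}" if "e \<in> (`) (wrap a n) ` E2" for e
    proof -
      have e: "e \<subseteq> {a + 1..n}" "card e = 2" using cut_tree_edgeD[OF t2 that] by auto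
      then have "e \<noteq> {}" by auto
      with e show ?thesis by fastforce
    qed
    have "\<not> {0, n} \<subseteq> {0..a}" "\<not> {0, n} \<subseteq> {a + 1..n}" using a by auto
    then show ?thesis unfolding F using t1 1 2 by blast
  qed
  show "inj_on ?f ?D"
  proof (rule inj_onI)
    fix u v assume u: "u \<in> ?D" and v: "v \<in> ?D" and uv: "?f u = ?f v"
    obtain a E1 E2 a' E1' E2' where u_eq: "u = (a, E1, E2)" and v_eq: "v = (a', E1', E2')"
      by (metis prod_cases3)
    have a: "a < n" "a' < n"
      and E: "E1 \<in> noncrossing_trees a" "E2 \<in> noncrossing_trees (n - 1 - a)"
        "E1' \<in> noncrossing_trees a'" "E2' \<in> noncrossing_trees (n - 1 - a')"
      and eq: "insert {0, n} (E1 \<union> (`) (wrap a n) ` E2) = insert {0, n} (E1' \<union> (`) (wrap a' n) ` E2')"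
      using u v uv by (simp_all add: u_eq v_eq)
    define F where "F = insert {0, n} (E1 \<union> (`) (wrap a n) ` E2)"
    note f = facts[OF a(1) E(1,2) F_def]
    note f' = facts[OF a(2) E(3,4) F_def[unfolded eq]]
    \<comment> \<open>If \<open>b < b'\<close>, the tree on \<open>{0..b'}\<close> has an edge that leaves \<open>{0..b}\<close>.\<close>
    have le: "b' \<le> b"
      if t: "cut_tree {0..b'} D'" "b' < n" and D: "{e \<in> F. e \<subseteq> {0..b'}} = D'"
        and sides: "\<forall>e\<in>F. e \<noteq> {0, n} \<longrightarrow> e \<subseteq> {0..b} \<or> e \<subseteq> {b + 1..n}" for b b' D'
    proof (rule ccontr)
      assume "\<not> b' \<le> b"
      then have "splits {0..b} {0..b'}" by (auto simp: splits_def)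
      then obtain e where e: "e \<in> D'" "splits {0..b} e" using cut_tree_connected[OF t(1)] by blast
      then have "e \<in> F" "e \<subseteq> {0..b'}" using D by auto
      moreover have "e \<noteq> {0, n}" using calculation(2) t(2) by auto
      ultimately have "e \<subseteq> {0..b} \<or> e \<subseteq> {b + 1..n}" using sides by blast
      then show False using e(2) by (auto simp: splits_def)
    qed
    have aa: "a = a'"
      using le[of a' E1' a] le[of a E1 a'] f f' a by simp
    have "E1 = {e \<in> F. e \<subseteq> {0..a}}" "(`) (wrap a n) ` E2 = {e \<in> F. e \<subseteq> {a + 1..n}}"
      using f by simp_all
    moreover have "E1' = {e \<in> F. e \<subseteq> {0..a}}" "(`) (wrap a n) ` E2' = {e \<in> F. e \<subseteq> {a + 1..n}}"
      using f' unfolding aa by simp_all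
    ultimately have eqs: "E1 = E1'" "(`) (wrap a n) ` E2 = (`) (wrap a n) ` E2'" by simp_all
    have inj: "inj_on ((`) ((`) (wrap a n))) (Pow (Pow {0..n - 1 - a}))"
      by (rule inj_on_image_image, rule inj_on_wrap) (use a in simp)
    have "E2 = E2'"
      by (rule inj_onD[OF inj eqs(2)]) (use noncrossing_trees_subset E(2,4) aa in simp_all)
    then show "u = v" using aa eqs(1) by (simp add: u_eq v_eq)
  qed
  show "?f ` ?D = edge_trees n"
  proof (intro equalityI subsetI)
    fix E assume "E \<in> ?f ` ?D"
    then obtain a E1 E2 where a: "a < n" and E: "E1 \<in> noncrossing_trees a" "E2 \<in> noncrossing_trees (n - 1 - a)"
      "E = insert {0, n} (E1 \<union> (`) (wrap a n) ` E2)"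
      by auto
    have "n = a + 1 + (n - 1 - a)" using a by simp
    from join_by_outer_edge_iff[OF this noncrossing_trees_subset[OF E(1)] noncrossing_trees_subset[OF E(2)]]
    show "E \<in> edge_trees n" using E by (simp add: edge_trees_def)
  next
    fix E assume E: "E \<in> edge_trees n"
    then obtain a where a: "a < n" and sides: "\<And>e. e \<in> E \<Longrightarrow> e \<noteq> {0, n} \<Longrightarrow> e \<subseteq> {0..a} \<or> e \<subseteq> {a + 1..n}"
      using outer_edge_sides by blast
    have n: "n = a + 1 + (n - 1 - a)" using a by simp
    have e0: "{0, n} \<in> E" and En: "E \<in> noncrossing_trees n" using E by (simp_all add: edge_trees_def)
    define E1 where "E1 = {e \<in> E. e \<subseteq> {0..a}}"
    define E2' where "E2' = {e \<in> E. e \<subseteq> {a + 1..n}}"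
    have "E2' \<subseteq> Pow (wrap a n ` {0..n - 1 - a})" unfolding wrap_image[OF n] by (auto simp: E2'_def)
    from subset_image_image[OF this]
    obtain E2 where E2: "E2 \<subseteq> Pow {0..n - 1 - a}" "E2' = (`) (wrap a n) ` E2" by blast
    have EE: "E = insert {0, n} (E1 \<union> (`) (wrap a n) ` E2)"
      unfolding E2(2)[symmetric] E1_def E2'_def using sides e0 by blast
    have "E1 \<in> noncrossing_trees a \<and> E2 \<in> noncrossing_trees (n - 1 - a)"
      using join_by_outer_edge_iff[OF n _ E2(1), of E1] En unfolding EE[symmetric]
      by (auto simp: E1_def)
    then have "(a, E1, E2) \<in> ?D" using a by simp
    then show "E \<in> ?f ` ?D" by (rule rev_image_eqI) (simp add: EE)
  qed
qed

section \<open>Depths and their sums over all nodes\<close>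

text \<open>A path inside a subtree is a path of the whole tree, and paths are unique.\<close>

lemma depth_subtree:
  assumes "cut_tree V E" "cut_tree W E1" "E1 \<subseteq> E" "0 \<in> W" "r \<in> W"
  shows "depth E r = depth E1 r"
proof -
  obtain p where p: "path_between E1 0 p r" using cut_tree_path[OF assms(2,4,5)] .
  show ?thesis
    using depth_eq[OF assms(2) p] depth_eq[OF assms(1) path_between_mono[OF p assms(3)]] by simp
qed

text \<open>The path to a node of a subtree whose root \<open>f 0\<close> is a neighbour of \<open>0\<close> is the path inside the subtree
  with \<open>0\<close> put in front.\<close>

lemma depth_hanging_subtree:
  assumes t: "cut_tree V E" and t2: "cut_tree W E2" and inj: "inj_on f W"
    and sub: "(`) f ` E2 \<subseteq> E" and edge: "{0, f 0} \<in> E" and "0 \<notin> f ` W" "0 \<in> W" "s \<in> W"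
  shows "depth E (f s) = Suc (depth E2 s)"
proof -
  obtain p where p: "path_between E2 0 p s" using cut_tree_path[OF t2 \<open>0 \<in> W\<close> \<open>s \<in> W\<close>] .
  have pW: "set p \<subseteq> W" by (rule path_between_subset[OF p]) (use t2 cut_tree_edgeD \<open>0 \<in> W\<close> in blast)+
  have "path_between ((`) f ` E2) (f 0) (map f p) (f s)"
    by (rule path_between_image[OF p inj_on_subset[OF inj pW]])
  from path_between_mono[OF this sub] have q: "path_between E (f 0) (map f p) (f s)" .
  have "path_between E 0 (0 # map f p) (f s)"
    using q edge pW assms(6) by (auto simp: path_between_def successively_Cons)
  then have "depth E (f s) = length p" using depth_eq[OF t] by fastforce
  moreover have "p \<noteq> []" using p by (simp add: path_between_def)
  ultimately show ?thesis using depth_eq[OF t2 p] by simp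
qed

lemma depth_root: "cut_tree V E \<Longrightarrow> depth E 0 = 0"
  using depth_eq[of V E "[0]" 0] by (simp add: path_between_def)

context
  fixes x y :: "'a::comm_ring_1"
begin

definition node_sum :: "nat \<Rightarrow> nat set set \<Rightarrow> 'a" where
  "node_sum n E = (\<Sum>r\<le>n. x ^ r * y ^ depth E r)"

text \<open>The second tree is one level deeper.  Its nodes other than the root, which contribute
  \<open>node_sum m E2 - 1\<close>, are moved by \<open>a\<close>, while its root is moved to \<open>n\<close> and contributes the
  last term.\<close>

lemma node_sum_outer_edge:
  assumes n: "n = a + 1 + m" and E1: "E1 \<in> noncrossing_trees a" and E2: "E2 \<in> noncrossing_trees m"
    and E: "E = insert {0, n} (E1 \<union> (`) (wrap a n) ` E2)"
  shows "node_sum n E = node_sum a E1 + x ^ a * y * (node_sum m E2 - 1) + x ^ n * y"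
proof -
  have t: "cut_tree {0..n} E" "cut_tree {0..a} E1" "cut_tree {0..m} E2"
    using join_by_outer_edge_iff[OF n noncrossing_trees_subset[OF E1] noncrossing_trees_subset[OF E2]] E1 E2
    by (simp_all add: E noncrossing_trees_iff)
  have d1: "depth E r = depth E1 r" if "r \<le> a" for r
    by (rule depth_subtree[OF t(1,2)]) (use that E in auto)
  have d2: "depth E (wrap a n s) = Suc (depth E2 s)" if "s \<le> m" for s
    by (rule depth_hanging_subtree[OF t(1,3) inj_on_wrap[OF n]])
      (use that in \<open>auto simp: E wrap_image[OF n], auto simp: wrap_def\<close>)
  have "node_sum n E = (\<Sum>r\<le>a. x ^ r * y ^ depth E r) + (\<Sum>r\<in>{a + 1..n}. x ^ r * y ^ depth E r)"
  proof -
    have "{..n} = {..a} \<union> {a + 1..n}" using n by auto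
    then show ?thesis unfolding node_sum_def by (simp add: sum.union_disjoint)
  qed
  also have "(\<Sum>r\<le>a. x ^ r * y ^ depth E r) = node_sum a E1"
    unfolding node_sum_def by (rule sum.cong) (simp_all add: d1)
  also have "(\<Sum>r\<in>{a + 1..n}. x ^ r * y ^ depth E r) =
      (\<Sum>s\<in>{0..m}. x ^ wrap a n s * y ^ depth E (wrap a n s))"
    unfolding wrap_image[OF n, symmetric] by (subst sum.reindex[OF inj_on_wrap[OF n]]) simp
  also have "\<dots> = x ^ wrap a n 0 * y ^ depth E (wrap a n 0) +
      (\<Sum>s\<in>{0<..m}. x ^ wrap a n s * y ^ depth E (wrap a n s))"
    by (subst sum.head) simp_all
  also have "x ^ wrap a n 0 * y ^ depth E (wrap a n 0) = x ^ n * y"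
    using d2[of 0] by (simp add: depth_root[OF t(3)] wrap_def)
  also have "(\<Sum>s\<in>{0<..m}. x ^ wrap a n s * y ^ depth E (wrap a n s)) =
      (\<Sum>s\<in>{0<..m}. x ^ a * y * (x ^ s * y ^ depth E2 s))"
    by (rule sum.cong) (simp_all add: d2, simp add: wrap_def power_add mult_ac)
  also have "(\<Sum>s\<in>{0<..m}. x ^ a * y * (x ^ s * y ^ depth E2 s)) = x ^ a * y * (node_sum m E2 - 1)"
    unfolding node_sum_def atLeast0AtMost[symmetric]
    by (subst sum.head) (simp_all add: depth_root[OF t(3)] sum_distrib_left)
  finally show ?thesis by (simp add: algebra_simps)
qed

text \<open>Node \<open>c\<close> belongs to both trees and has depth \<open>1\<close>, so \<open>x ^ c * y\<close> has to be subtracted once.\<close>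

lemma node_sum_last_neighbour:
  assumes c: "1 \<le> c" "c \<le> n" and E1: "E1 \<in> edge_trees c" and E2: "E2 \<in> noncrossing_trees (n - c)"
    and E: "E = E1 \<union> (`) ((+) c) ` E2"
  shows "node_sum n E = node_sum c E1 - x ^ c * y + x ^ c * y * node_sum (n - c) E2"
proof -
  have E1': "E1 \<in> noncrossing_trees c" and e0: "{0, c} \<in> E1" using E1 by (simp_all add: edge_trees_def)
  have t: "cut_tree {0..n} E" "cut_tree {0..c} E1" "cut_tree {0..n - c} E2"
    using glue_at_vertex_iff[OF c(2) noncrossing_trees_subset[OF E1'] noncrossing_trees_subset[OF E2]] E1' E2
    by (simp_all add: E noncrossing_trees_iff)
  have d1: "depth E r = depth E1 r" if "r \<le> c" for r
    by (rule depth_subtree[OF t(1,2)]) (use that E in auto)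
  have d2: "depth E (c + s) = Suc (depth E2 s)" if "s \<le> n - c" for s
    by (rule depth_hanging_subtree[OF t(1,3)]) (use that e0 c in \<open>auto simp: E\<close>)
  have "depth E1 c = 1"
    using depth_eq[OF t(2), of "[0, c]" c] e0 c by (simp add: path_between_def)
  have "node_sum n E = (\<Sum>r<c. x ^ r * y ^ depth E r) + (\<Sum>r\<in>{c..n}. x ^ r * y ^ depth E r)"
  proof -
    have "{..n} = {..<c} \<union> {c..n}" using c by auto
    then show ?thesis unfolding node_sum_def by (simp add: sum.union_disjoint ivl_disj_int)
  qed
  also have "(\<Sum>r<c. x ^ r * y ^ depth E r) = node_sum c E1 - x ^ c * y"
    unfolding node_sum_def lessThan_Suc_atMost[symmetric] by (simp add: d1 \<open>depth E1 c = 1\<close>)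
  also have "{c..n} = (+) c ` {0..n - c}" using c by simp
  also have "(\<Sum>r\<in>(+) c ` {0..n - c}. x ^ r * y ^ depth E r) =
      (\<Sum>s\<in>{0..n - c}. x ^ (c + s) * y ^ depth E (c + s))"
    by (subst sum.reindex) simp_all
  also have "\<dots> = x ^ c * y * node_sum (n - c) E2"
    unfolding node_sum_def sum_distrib_left atLeast0AtMost
    by (rule sum.cong) (simp_all add: d2 power_add mult_ac)
  finally show ?thesis .
qed

definition tree_count :: "nat \<Rightarrow> 'a" where
  "tree_count n = of_nat (card (noncrossing_trees n))"

definition edge_count :: "nat \<Rightarrow> 'a" where
  "edge_count n = of_nat (card (edge_trees n))"

definition tree_sum :: "nat \<Rightarrow> 'a" where
  "tree_sum n = (\<Sum>E\<in>noncrossing_trees n. node_sum n E)"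

definition edge_sum :: "nat \<Rightarrow> 'a" where
  "edge_sum n = (\<Sum>E\<in>edge_trees n. node_sum n E)"

lemma sum_noncrossing_trees:
  assumes "n \<ge> 1"
  shows "(\<Sum>E\<in>noncrossing_trees n. f E) =
    (\<Sum>c\<in>{1..n}. \<Sum>E1\<in>edge_trees c. \<Sum>E2\<in>noncrossing_trees (n - c). f (E1 \<union> (`) ((+) c) ` E2))"
  unfolding sum.reindex_bij_betw[OF bij_betw_last_neighbour[OF assms], of f, symmetric]
  by (simp add: sum.Sigma sum.cartesian_product split_def)

lemma sum_edge_trees:
  "(\<Sum>E\<in>edge_trees n. f E) =
    (\<Sum>a<n. \<Sum>E1\<in>noncrossing_trees a. \<Sum>E2\<in>noncrossing_trees (n - 1 - a).
      f (insert {0, n} (E1 \<union> (`) (wrap a n) ` E2)))"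
  unfolding sum.reindex_bij_betw[OF bij_betw_outer_edge, of f, symmetric]
  by (simp add: sum.Sigma sum.cartesian_product split_def)

lemma tree_count_rec: "n \<ge> 1 \<Longrightarrow> tree_count n = (\<Sum>c\<in>{1..n}. edge_count c * tree_count (n - c))"
  using sum_noncrossing_trees[of n "\<lambda>_. 1::'a"] by (simp add: tree_count_def edge_count_def)

lemma edge_count_rec: "edge_count n = (\<Sum>a<n. tree_count a * tree_count (n - 1 - a))"
  using sum_edge_trees[of "\<lambda>_. 1::'a" n] by (simp add: tree_count_def edge_count_def)

lemma tree_sum_rec:
  assumes "n \<ge> 1"
  shows "tree_sum n = (\<Sum>c\<in>{1..n}. (edge_sum c - x ^ c * y * edge_count c) * tree_count (n - c) +
    x ^ c * y * edge_count c * tree_sum (n - c))"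
proof -
  have "tree_sum n = (\<Sum>c\<in>{1..n}. \<Sum>E1\<in>edge_trees c. \<Sum>E2\<in>noncrossing_trees (n - c).
      node_sum c E1 - x ^ c * y + x ^ c * y * node_sum (n - c) E2)"
    unfolding tree_sum_def sum_noncrossing_trees[OF assms]
    by (intro sum.cong refl node_sum_last_neighbour) auto
  also have "\<dots> = (\<Sum>c\<in>{1..n}. (edge_sum c - x ^ c * y * edge_count c) * tree_count (n - c) +
    x ^ c * y * edge_count c * tree_sum (n - c))"
    unfolding edge_sum_def edge_count_def tree_count_def tree_sum_def
    by (simp add: sum.distrib sum_subtractf sum_distrib_left sum_distrib_right algebra_simps)
  finally show ?thesis .
qed

lemma edge_sum_rec:
  "edge_sum n = (\<Sum>a<n. tree_sum a * tree_count (n - 1 - a) +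
    x ^ a * tree_count a * y * (tree_sum (n - 1 - a) - tree_count (n - 1 - a))) + x ^ n * y * edge_count n"
proof -
  have "edge_sum n = (\<Sum>a<n. \<Sum>E1\<in>noncrossing_trees a. \<Sum>E2\<in>noncrossing_trees (n - 1 - a).
      node_sum a E1 + x ^ a * y * (node_sum (n - 1 - a) E2 - 1) + x ^ n * y)"
    unfolding edge_sum_def sum_edge_trees
    by (intro sum.cong refl node_sum_outer_edge) auto
  also have "\<dots> = (\<Sum>a<n. tree_sum a * tree_count (n - 1 - a) +
    x ^ a * tree_count a * y * (tree_sum (n - 1 - a) - tree_count (n - 1 - a)) +
    x ^ n * y * (tree_count a * tree_count (n - 1 - a)))"
    unfolding tree_count_def tree_sum_def
    by (simp add: sum.distrib sum_subtractf sum_distrib_left sum_distrib_right algebra_simps)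
  finally show ?thesis unfolding edge_count_rec[of n] by (simp add: sum.distrib sum_distrib_left)
qed

end

section \<open>Generating functions\<close>

unbundle no vec_syntax and fps_syntax

lemma fps_nth_mult_0_left:
  fixes f g :: "'a::comm_ring_1 fps"
  assumes "f $ 0 = 0"
  shows "(f * g) $ n = (\<Sum>c\<in>{1..n}. f $ c * g $ (n - c))"
  using assms unfolding fps_mult_nth by (subst sum.atLeast_Suc_atMost) simp_all

lemma fps_nth_X_mult:
  fixes f g :: "'a::comm_ring_1 fps"
  shows "(fps_X * (f * g)) $ n = (\<Sum>a<n. f $ a * g $ (n - 1 - a))"
  unfolding fps_X_mult_nth fps_mult_nth[of f]
  by (cases n) (simp_all add: lessThan_Suc_atMost atLeast0AtMost)

text \<open>With \<open>z = fps_X\<close>, let \<open>P\<close> and \<open>PB\<close> be the analogues of \<open>A\<close> and \<open>B\<close>, and \<open>Q\<close> that of \<open>F\<close>, for trees that contain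
  the edge \<open>{0, n}\<close>.  Removing this edge gives
    \<open>P = z A\<^sup>2\<close>, \<open>PB = u z B\<^sup>2\<close>, \<open>Q = z F A + v z B (F - A) + v PB\<close>,
  and cutting at the last neighbour of the root gives
    \<open>A = 1 + P A\<close>, \<open>F = 1 + (Q - v PB) A + v PB F\<close>.
  The term \<open>v PB\<close> cancels in \<open>Q - v PB\<close>.  As \<open>A - z A\<^sup>3 = 1\<close>, multiplication by \<open>A\<close> turns the resulting
  equation for \<open>F\<close> into \<open>F = A + v z A\<^sup>2 B (F - A) + u v z A B\<^sup>2 F\<close>, which is the claim because
  \<open>z A\<^sup>3 = A - 1\<close>.\<close>

lemma generating_function_equations:
  fixes x y :: "'a::comm_ring_1"
  defines "A \<equiv> Abs_fps tree_count" and "B \<equiv> Abs_fps (\<lambda>n. x ^ n * tree_count n)"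
    and "F \<equiv> Abs_fps (tree_sum x y)" and "u \<equiv> fps_const x" and "v \<equiv> fps_const y"
  shows "F * (1 - v * fps_X * A * B * (A + u * B)) = A + v * (1 - A) * B"
proof -
  define P where "P = Abs_fps (edge_count :: nat \<Rightarrow> 'a)"
  define PB where "PB = Abs_fps (\<lambda>n. x ^ n * edge_count n)"
  define Q where "Q = Abs_fps (edge_sum x y)"
  note defs = A_def B_def F_def P_def PB_def Q_def
  have zero: "edge_count 0 = (0::'a)" "tree_count 0 = (1::'a)" "edge_sum x y 0 = 0" "tree_sum x y 0 = 1"
    using depth_root[of "{0..0}" "{}"] noncrossing_trees_iff[of "{}" 0]
    by (simp_all add: edge_count_def tree_count_def noncrossing_trees_0 edge_sum_def tree_sum_def node_sum_def)
  have P: "P = fps_X * (A * A)"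
    by (rule fps_ext) (simp add: fps_nth_X_mult edge_count_rec defs del: fps_X_mult_nth)
  have PB: "PB = u * (fps_X * (B * B))"
  proof (rule fps_ext)
    fix n
    have "(\<Sum>a<n. tree_count a * tree_count (n - 1 - a) * x ^ n) =
        (\<Sum>a<n. x * (x ^ a * tree_count a * (x ^ (n - 1 - a) * tree_count (n - 1 - a))))"
    proof (rule sum.cong)
      fix a assume "a \<in> {..<n}"
      then have "n = Suc (a + (n - 1 - a))" by simp
      then have "x ^ n = x * (x ^ a * x ^ (n - 1 - a))" by (metis power_Suc power_add)
      then show "tree_count a * tree_count (n - 1 - a) * x ^ n =
          x * (x ^ a * tree_count a * (x ^ (n - 1 - a) * tree_count (n - 1 - a)))"
        by (simp add: mult_ac)
    qed simp
    then show "PB $ n = (u * (fps_X * (B * B))) $ n"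
      unfolding u_def fps_mult_left_const_nth fps_nth_X_mult
      by (simp add: edge_count_rec[of n] defs sum_distrib_left sum_distrib_right mult_ac)
  qed
  have A: "A = 1 + P * A"
  proof (rule fps_ext)
    fix n show "A $ n = (1 + P * A) $ n"
      using tree_count_rec[of n, where 'a = 'a]
      by (cases n) (simp_all add: fps_nth_mult_0_left defs zero)
  qed
  have F: "F = 1 + ((Q - v * PB) * A + v * PB * F)"
  proof (rule fps_ext)
    fix n
    have 1: "((Q - v * PB) * A) $ n =
        (\<Sum>c\<in>{1..n}. (edge_sum x y c - x ^ c * y * edge_count c) * tree_count (n - c))"
      by (subst fps_nth_mult_0_left) (simp_all add: defs zero v_def mult_ac)
    have 2: "(v * PB * F) $ n = (\<Sum>c\<in>{1..n}. x ^ c * y * edge_count c * tree_sum x y (n - c))"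
      by (subst fps_nth_mult_0_left) (simp_all add: defs zero v_def mult_ac)
    show "F $ n = (1 + ((Q - v * PB) * A + v * PB * F)) $ n"
      unfolding fps_add_nth 1 2 using tree_sum_rec[of n x y]
      by (cases n) (simp_all add: F_def zero sum.distrib)
  qed
  have Q: "Q = fps_X * (F * A) + v * (fps_X * (B * (F - A))) + v * PB"
  proof (rule fps_ext)
    fix n show "Q $ n = (fps_X * (F * A) + v * (fps_X * (B * (F - A))) + v * PB) $ n"
      using edge_sum_rec[of x y n]
      by (simp add: fps_nth_X_mult v_def del: fps_X_mult_nth) (simp add: defs sum.distrib sum_distrib_left mult_ac)
  qed
  have A3: "A - fps_X * (A * A * A) = 1" "fps_X * (A * A * A) = A - 1"
    using A unfolding P by (simp_all add: algebra_simps)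
  have "F = 1 + ((fps_X * (F * A) + v * (fps_X * (B * (F - A)))) * A + v * (u * (fps_X * (B * B))) * F)"
    using F unfolding Q PB by simp
  from arg_cong[OF this, of "\<lambda>t. t * A"]
  have "F * (A - fps_X * (A * A * A)) =
      A + v * fps_X * A * A * B * (F - A) + v * fps_X * A * B * (u * B) * F"
    by (simp add: algebra_simps)
  then have "F * (1 - v * fps_X * A * B * (A + u * B)) = A - v * B * (fps_X * (A * A * A))"
    unfolding A3(1) by (simp add: algebra_simps)
  then show ?thesis unfolding A3(2) by (simp add: algebra_simps)
qed

text \<open>The coefficients \<open>rat fps fps\<close> do not form a field, but a series with constant coefficient \<open>1\<close> is
  still a unit.\<close>

lemma fps_divide_eq_of_nth_0_eq_1:
  fixes f g h :: "rat fps fps fps"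
  assumes "f * g = h" "g $ 0 = 1"
  shows "f = h / g"
proof -
  have inv1: "inverse (1 :: rat fps fps) = 1" by (intro fps_inverse_one' fps_inverse_one)
  have "g * inverse g = 1"
    unfolding fps_inverse_def[of g] by (rule fps_right_inverse) (simp add: assms(2) inv1)
  moreover have "subdegree g = 0" using assms(2) by (simp add: subdegree_eq_0)
  ultimately have "h / g = f * (g * inverse g)"
    unfolding fps_divide_def assms(1)[symmetric] by (simp add: fps_unit_factor_def mult.assoc)
  with \<open>g * inverse g = 1\<close> show ?thesis by simp
qed

lemma T_var_z: "T var_z = Abs_fps tree_count"
  unfolding T_def var_z_def tree_count_def by simp

lemma T_var_x_var_z: "T (var_x * var_z) = Abs_fps (\<lambda>n. fps_const fps_X ^ n * tree_count n)"
proof (rule fps_ext)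
  fix n
  have "(var_x * var_z) ^ i $ n = (if i = n then fps_const fps_X ^ n else 0)" for i
    unfolding var_x_def var_z_def power_mult_distrib fps_const_power
    by (simp add: fps_mult_left_const_nth fps_X_power_nth)
  then show "T (var_x * var_z) $ n = Abs_fps (\<lambda>n. fps_const fps_X ^ n * tree_count n) $ n"
    unfolding T_def fps_compose_nth by (simp add: tree_count_def mult_delta_right mult.commute)
qed

lemma nth_monomial:
  "(fps_const fps_X ^ r * fps_X ^ d :: rat fps fps) $ d' $ r' = (if d = d' \<and> r = r' then 1 else 0)"
  by (simp add: fps_const_power fps_mult_left_const_nth fps_X_power_nth)

lemma G_eq: "G = Abs_fps (tree_sum (fps_const fps_X) fps_X)"
proof (intro fps_ext)
  fix n d r
  have "Abs_fps (tree_sum (fps_const fps_X) fps_X) $ n $ d $ r =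
      (\<Sum>E\<in>noncrossing_trees n. \<Sum>r'\<le>n. (fps_const fps_X ^ r' * fps_X ^ depth E r' :: rat fps fps) $ d $ r)"
    by (simp add: tree_sum_def node_sum_def fps_sum_nth)
  also have "\<dots> = (\<Sum>E\<in>noncrossing_trees n. if r \<le> n \<and> depth E r = d then 1 else 0)"
  proof (rule sum.cong[OF refl])
    fix E
    have "(\<Sum>r'\<le>n. if depth E r' = d \<and> r' = r then 1 else 0 :: rat) =
        (\<Sum>r'\<le>n. if r' = r then (if depth E r = d then 1 else 0) else 0)"
      by (rule sum.cong) auto
    then show "(\<Sum>r'\<le>n. (fps_const fps_X ^ r' * fps_X ^ depth E r' :: rat fps fps) $ d $ r) =
        (if r \<le> n \<and> depth E r = d then 1 else 0)"
      unfolding nth_monomial by simp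
  qed
  also have "\<dots> = of_nat (card {E \<in> noncrossing_trees n. r \<le> n \<and> depth E r = d})"
    by (simp add: sum.If_cases Int_def)
  finally show "G $ n $ d $ r = Abs_fps (tree_sum (fps_const fps_X) fps_X) $ n $ d $ r"
    by (simp add: G_def)
qed

theorem theorem6p1:
  fixes x y z :: series
  defines "x \<equiv> var_x" and "y \<equiv> var_y" and "z \<equiv> var_z"
  shows "G = (T z + y * (1 - T z) * T (x * z)) /
             (1 - y * z * T z * T (x * z) * (T z + x * T (x * z)))"
proof (rule fps_divide_eq_of_nth_0_eq_1)
  show "G * (1 - y * z * T z * T (x * z) * (T z + x * T (x * z))) = T z + y * (1 - T z) * T (x * z)"
    using generating_function_equations[of "fps_const fps_X :: rat fps fps" fps_X]
    unfolding x_def y_def z_def T_var_x_var_z T_var_z G_eq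
    by (simp add: var_x_def var_y_def var_z_def)
  show "(1 - y * z * T z * T (x * z) * (T z + x * T (x * z))) $ 0 = 1"
    by (simp add: z_def var_z_def)
qed

end
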